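(* For every $n\in\mathbb{N}$, the inclusion $\mathrm{PSL}(n,\mathbb{Z})\leq\mathrm{PGL}(n,\mathbb{Q})$ is $C^*$-irreducible.
   Context: Groups are discrete. $\mathrm{PSL}(n,\mathbb{Z})$ is the quotient of $\mathrm{SL}(n,\mathbb{Z})$ by its scalar matrices and is viewed as a subgroup of $\mathrm{PGL}(n,\mathbb{Q})=\mathrm{GL}(n,\mathbb{Q})/\{\text{scalar matrices}\}$ in the natural way. An inclusion of groups $\Lambda\leq\Gamma$ is $C^*$-irreducible if every intermediate $C^*$-algebra $B$ of the inclusion of reduced group $C^*$-algebras, $C^*_r(\Lambda)\subset B\subset C^*_r(\Gamma)$, is simple. *)

theory Defs
  imports
    "HOL-Analysis.Infinite_Sum"
    "HOL-Analysis.Bounded_Linear_Function"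
    "HOL-Algebra.Coset"
    "Jordan_Normal_Form.Determinant"
begin

section \<open>The Hilbert space of square-summable functions\<close>

typedef 'a ell2 = "{f :: 'a \<Rightarrow> complex. (\<lambda>x. (cmod (f x))\<^sup>2) summable_on UNIV}"
  morphisms ell2_fun Abs_ell2
  by (rule exI[of _ "\<lambda>_. 0"]) simp

setup_lifting type_definition_ell2

lemma summable_ell2_fun: "(\<lambda>x. (cmod (ell2_fun f x))\<^sup>2) summable_on UNIV"
  using ell2_fun[of f] by simp

lemma summable_ell2_mult:
  "(\<lambda>x. cmod (ell2_fun f x) * cmod (ell2_fun g x)) summable_on UNIV"
proof (rule summable_on_comparison_test)
  show "(\<lambda>x. (cmod (ell2_fun f x))\<^sup>2 + (cmod (ell2_fun g x))\<^sup>2) summable_on UNIV"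
    by (intro summable_on_add summable_ell2_fun)
  fix x
  show "cmod (ell2_fun f x) * cmod (ell2_fun g x)
      \<le> (cmod (ell2_fun f x))\<^sup>2 + (cmod (ell2_fun g x))\<^sup>2"
    using sum_squares_bound[of "cmod (ell2_fun f x)" "cmod (ell2_fun g x)"]
      mult_nonneg_nonneg[OF norm_ge_zero[of "ell2_fun f x"] norm_ge_zero[of "ell2_fun g x"]]
    unfolding mult.assoc by linarith
qed auto

lemma summable_ell2_cinner:
  "(\<lambda>x. ell2_fun f x * cnj (ell2_fun g x)) summable_on UNIV"
  by (rule abs_summable_summable) (use summable_ell2_mult[of f g] in \<open>simp add: norm_mult\<close>)

lemma add_in_ell2:
  fixes f g :: "'a \<Rightarrow> complex"
  assumes "(\<lambda>x. (cmod (f x))\<^sup>2) summable_on UNIV" and "(\<lambda>x. (cmod (g x))\<^sup>2) summable_on UNIV"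
  shows "(\<lambda>x. (cmod (f x + g x))\<^sup>2) summable_on UNIV"
proof (rule summable_on_comparison_test)
  show "(\<lambda>x. 2 * (cmod (f x))\<^sup>2 + 2 * (cmod (g x))\<^sup>2) summable_on UNIV"
    by (intro summable_on_add summable_on_cmult_right assms)
  fix x
  have "(cmod (f x + g x))\<^sup>2 \<le> (cmod (f x) + cmod (g x))\<^sup>2"
    by (intro power_mono norm_triangle_ineq) auto
  also have "\<dots> \<le> 2 * (cmod (f x))\<^sup>2 + 2 * (cmod (g x))\<^sup>2"
    using sum_squares_bound[of "cmod (f x)" "cmod (g x)"] by (simp add: power2_sum)
  finally show "(cmod (f x + g x))\<^sup>2 \<le> 2 * (cmod (f x))\<^sup>2 + 2 * (cmod (g x))\<^sup>2" .
qed auto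

lift_definition ell2_scaleC :: "complex \<Rightarrow> 'a ell2 \<Rightarrow> 'a ell2" is "\<lambda>c f x. c * f x"
  by (simp add: norm_mult power_mult_distrib summable_on_cmult_right)

definition ell2_cinner :: "'a ell2 \<Rightarrow> 'a ell2 \<Rightarrow> complex" where
  "ell2_cinner f g = (\<Sum>\<^sub>\<infinity>x. ell2_fun f x * cnj (ell2_fun g x))"

instantiation ell2 :: (type) real_vector
begin

lift_definition zero_ell2 :: "'a ell2" is "\<lambda>_. 0" by simp
lift_definition plus_ell2 :: "'a ell2 \<Rightarrow> 'a ell2 \<Rightarrow> 'a ell2" is "\<lambda>f g x. f x + g x"
  by (rule add_in_ell2)
lift_definition uminus_ell2 :: "'a ell2 \<Rightarrow> 'a ell2" is "\<lambda>f x. - f x" by simp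
definition minus_ell2 :: "'a ell2 \<Rightarrow> 'a ell2 \<Rightarrow> 'a ell2" where "f - g = f + (- g)" for f g :: "'a ell2"
definition scaleR_ell2 :: "real \<Rightarrow> 'a ell2 \<Rightarrow> 'a ell2" where
  "scaleR_ell2 r = ell2_scaleC (complex_of_real r)"

instance
proof
  fix f g h :: "'a ell2" and a b :: real
  show "f + g + h = f + (g + h)" by transfer (simp add: add.assoc)
  show "f + g = g + f" by transfer (simp add: add.commute)
  show "0 + f = f" by transfer simp
  show "- f + f = 0" by transfer simp
  show "f - g = f + - g" by (rule minus_ell2_def)
  show "a *\<^sub>R (f + g) = a *\<^sub>R f + a *\<^sub>R g"
    unfolding scaleR_ell2_def by transfer (simp add: algebra_simps)
  show "(a + b) *\<^sub>R f = a *\<^sub>R f + b *\<^sub>R f"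
    unfolding scaleR_ell2_def by transfer (simp add: algebra_simps)
  show "a *\<^sub>R b *\<^sub>R f = (a * b) *\<^sub>R f"
    unfolding scaleR_ell2_def by transfer (simp add: algebra_simps)
  show "1 *\<^sub>R f = f"
    unfolding scaleR_ell2_def by transfer simp
qed

end

lemma ell2_cinner_add_left: "ell2_cinner (f + g) h = ell2_cinner f h + ell2_cinner g h"
  unfolding ell2_cinner_def plus_ell2.rep_eq distrib_right
  by (intro infsum_add summable_ell2_cinner)

lemma ell2_cinner_scaleC_left: "ell2_cinner (ell2_scaleC c f) h = c * ell2_cinner f h"
  unfolding ell2_cinner_def ell2_scaleC.rep_eq mult.assoc
  by (intro infsum_cmult_right summable_ell2_cinner)

lemma ell2_cinner_commute: "ell2_cinner f g = cnj (ell2_cinner g f)"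
proof -
  have "cnj (ell2_cinner g f) = (\<Sum>\<^sub>\<infinity>x. cnj (ell2_fun g x * cnj (ell2_fun f x)))"
    unfolding ell2_cinner_def by (rule infsum_cnj[symmetric])
  also have "\<dots> = ell2_cinner f g"
    unfolding ell2_cinner_def by (simp add: mult.commute)
  finally show ?thesis by (rule sym)
qed

lemma ell2_cinner_same:
  "ell2_cinner f f = complex_of_real (\<Sum>\<^sub>\<infinity>x. (cmod (ell2_fun f x))\<^sup>2)"
  unfolding ell2_cinner_def complex_norm_square[symmetric]
  by (intro infsumI iffD2[OF has_sum_of_real_iff] has_sum_infsum summable_ell2_fun)

text \<open>
  The library has real Hilbert spaces only; the real inner product is the real part of the
  complex one, so both induce the same norm.
\<close>

instantiation ell2 :: (type) real_inner
begin

definition inner_ell2 :: "'a ell2 \<Rightarrow> 'a ell2 \<Rightarrow> real" where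
  "inner_ell2 f g = Re (ell2_cinner f g)"
definition norm_ell2 :: "'a ell2 \<Rightarrow> real" where
  "norm_ell2 f = sqrt (\<Sum>\<^sub>\<infinity>x. (cmod (ell2_fun f x))\<^sup>2)"
definition dist_ell2 :: "'a ell2 \<Rightarrow> 'a ell2 \<Rightarrow> real" where
  "dist_ell2 f g = norm (f - g)"
definition sgn_ell2 :: "'a ell2 \<Rightarrow> 'a ell2" where
  "sgn_ell2 f = inverse (norm f) *\<^sub>R f"
definition uniformity_ell2 :: "('a ell2 \<times> 'a ell2) filter" where
  "uniformity_ell2 = (INF e\<in>{0 <..}. principal {(x, y). dist x y < e})"
definition open_ell2 :: "'a ell2 set \<Rightarrow> bool" where
  "open_ell2 U = (\<forall>x\<in>U. eventually (\<lambda>(x', y). x' = x \<longrightarrow> y \<in> U) uniformity)"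

instance
proof
  fix f g h :: "'a ell2" and r :: real and U :: "'a ell2 set"
  show "dist f g = norm (f - g)" by (rule dist_ell2_def)
  show "sgn f = inverse (norm f) *\<^sub>R f" by (rule sgn_ell2_def)
  show "(uniformity :: ('a ell2 \<times> 'a ell2) filter)
      = (INF e\<in>{0 <..}. principal {(x, y). dist x y < e})"
    by (rule uniformity_ell2_def)
  show "open U = (\<forall>x\<in>U. \<forall>\<^sub>F (x', y) in uniformity. x' = x \<longrightarrow> y \<in> U)"
    by (rule open_ell2_def)
  show "inner f g = inner g f"
    unfolding inner_ell2_def by (subst ell2_cinner_commute) simp
  show "inner (f + g) h = inner f h + inner g h"
    unfolding inner_ell2_def by (simp add: ell2_cinner_add_left)
  show "inner (r *\<^sub>R f) g = r * inner f g"
    unfolding inner_ell2_def scaleR_ell2_def by (simp add: ell2_cinner_scaleC_left)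
  show "0 \<le> inner f f"
    unfolding inner_ell2_def by (simp add: ell2_cinner_same infsum_nonneg)
  show "norm f = sqrt (inner f f)"
    unfolding inner_ell2_def norm_ell2_def by (simp add: ell2_cinner_same)
  show "inner f f = 0 \<longleftrightarrow> f = 0"
  proof
    assume "inner f f = 0"
    then have "(\<Sum>\<^sub>\<infinity>x. (cmod (ell2_fun f x))\<^sup>2) = 0"
      unfolding inner_ell2_def by (simp add: ell2_cinner_same)
    then have "(cmod (ell2_fun f x))\<^sup>2 = 0" for x
      using nonneg_infsum_le_0D[of "\<lambda>x. (cmod (ell2_fun f x))\<^sup>2" UNIV x] summable_ell2_fun[of f]
      by simp
    then show "f = 0" by transfer auto
  next
    assume "f = 0"
    then show "inner f f = 0"
      unfolding inner_ell2_def ell2_cinner_def by (simp add: zero_ell2.rep_eq)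
  qed
qed

end

lemma norm_ell2_scaleC: "norm (ell2_scaleC c f) = cmod c * norm f"
  unfolding norm_ell2_def ell2_scaleC.rep_eq norm_mult power_mult_distrib
  by (subst infsum_cmult_right) (simp_all add: summable_ell2_fun real_sqrt_mult)

section \<open>C*-algebras of operators\<close>

type_synonym 'a ell2_op = "'a ell2 \<Rightarrow>\<^sub>L 'a ell2"

lemma bounded_linear_ell2_scaleC: "bounded_linear (ell2_scaleC c)"
proof (rule bounded_linear_intro)
  fix f g :: "'a ell2" and r :: real
  show "ell2_scaleC c (f + g) = ell2_scaleC c f + ell2_scaleC c g"
    by transfer (simp add: algebra_simps)
  show "ell2_scaleC c (r *\<^sub>R f) = r *\<^sub>R ell2_scaleC c f"
    unfolding scaleR_ell2_def by transfer (simp add: algebra_simps)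
  show "norm (ell2_scaleC c f) \<le> norm f * cmod c"
    by (simp add: norm_ell2_scaleC)
qed

definition op_scaleC :: "complex \<Rightarrow> 'a ell2_op \<Rightarrow> 'a ell2_op" where
  "op_scaleC c T = Blinfun (ell2_scaleC c) o\<^sub>L T"

lemma op_scaleC_apply: "op_scaleC c T f = ell2_scaleC c (T f)"
  unfolding op_scaleC_def by (simp add: bounded_linear_Blinfun_apply bounded_linear_ell2_scaleC)

definition is_adjoint :: "'a ell2_op \<Rightarrow> 'a ell2_op \<Rightarrow> bool" where
  "is_adjoint T S \<longleftrightarrow> (\<forall>f g. ell2_cinner (T f) g = ell2_cinner f (S g))"

definition complex_subspace :: "'a ell2_op set \<Rightarrow> bool" where
  "complex_subspace B \<longleftrightarrow>
     0 \<in> B \<and> (\<forall>S\<in>B. \<forall>T\<in>B. S + T \<in> B) \<and> (\<forall>c. \<forall>T\<in>B. op_scaleC c T \<in> B)"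

text \<open>
  Elements of \<^typ>\<open>'a ell2_op\<close> are only real-linear a priori. An operator with an adjoint for
  the complex inner product is complex-linear, so the members of a C*-algebra below are
  complex-linear. A C*-algebra need not contain the identity operator.
\<close>

definition cstar_algebra :: "'a ell2_op set \<Rightarrow> bool" where
  "cstar_algebra B \<longleftrightarrow>
     complex_subspace B \<and>
     (\<forall>S\<in>B. \<forall>T\<in>B. S o\<^sub>L T \<in> B) \<and>
     (\<forall>T\<in>B. \<exists>S\<in>B. is_adjoint T S) \<and>
     closed B"

definition closed_two_sided_ideal :: "'a ell2_op set \<Rightarrow> 'a ell2_op set \<Rightarrow> bool" where
  "closed_two_sided_ideal I B \<longleftrightarrow>
     I \<subseteq> B \<and> complex_subspace I \<and>
     (\<forall>T\<in>B. \<forall>S\<in>I. T o\<^sub>L S \<in> I \<and> S o\<^sub>L T \<in> I) \<and>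
     closed I"

definition simple_cstar_algebra :: "'a ell2_op set \<Rightarrow> bool" where
  "simple_cstar_algebra B \<longleftrightarrow>
     cstar_algebra B \<and> B \<noteq> {0} \<and>
     (\<forall>I. closed_two_sided_ideal I B \<longrightarrow> I = {0} \<or> I = B)"

section \<open>Reduced group C*-algebras\<close>

text \<open>
  The Hilbert space of a group \<open>G\<close> is the subspace of \<^typ>\<open>'a ell2\<close> of functions vanishing off
  \<^term>\<open>carrier G\<close>. Its operators are extended by zero to the orthogonal complement; this
  extension is isometric and compatible with all the *-algebra operations.
\<close>

definition left_translate :: "('a, 'b) monoid_scheme \<Rightarrow> 'a \<Rightarrow> 'a ell2 \<Rightarrow> 'a ell2" where
  "left_translate G g f =
     Abs_ell2 (\<lambda>x. if x \<in> carrier G then ell2_fun f (inv\<^bsub>G\<^esub> g \<otimes>\<^bsub>G\<^esub> x) else 0)"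

definition left_regular :: "('a, 'b) monoid_scheme \<Rightarrow> 'a \<Rightarrow> 'a ell2_op" where
  "left_regular G g = Blinfun (left_translate G g)"

context group
begin

lemma left_mult_bij: "g \<in> carrier G \<Longrightarrow> bij_betw (\<lambda>x. inv g \<otimes> x) (carrier G) (carrier G)"
  by (rule bij_betwI[where g = "\<lambda>x. g \<otimes> x"]) (auto simp: m_assoc[symmetric])

lemma left_translate_summable:
  assumes g: "g \<in> carrier G"
  shows "(\<lambda>x. (cmod (if x \<in> carrier G then ell2_fun f (inv g \<otimes> x) else 0))\<^sup>2) summable_on UNIV"
    and "(\<Sum>\<^sub>\<infinity>x. (cmod (if x \<in> carrier G then ell2_fun f (inv g \<otimes> x) else 0))\<^sup>2)
      \<le> (\<Sum>\<^sub>\<infinity>x. (cmod (ell2_fun f x))\<^sup>2)"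
proof -
  let ?h = "\<lambda>x. (cmod (ell2_fun f x))\<^sup>2"
  let ?k = "\<lambda>x. (cmod (if x \<in> carrier G then ell2_fun f (inv g \<otimes> x) else 0))\<^sup>2"
  have h: "?h summable_on carrier G"
    by (rule summable_on_subset_banach[OF summable_ell2_fun]) simp
  have "(\<lambda>x. ?h (inv g \<otimes> x)) summable_on carrier G"
    using summable_on_reindex_bij_betw[OF left_mult_bij[OF g], of ?h] h by simp
  also have "?this \<longleftrightarrow> ?k summable_on UNIV"
    by (rule summable_on_cong_neutral) auto
  finally show "?k summable_on UNIV" .
  have "(\<Sum>\<^sub>\<infinity>x. ?k x) = (\<Sum>\<^sub>\<infinity>x\<in>carrier G. ?h (inv g \<otimes> x))"
    by (rule infsum_cong_neutral) auto
  also have "\<dots> = (\<Sum>\<^sub>\<infinity>x\<in>carrier G. ?h x)"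
    by (rule infsum_reindex_bij_betw[OF left_mult_bij[OF g]])
  also have "\<dots> \<le> (\<Sum>\<^sub>\<infinity>x. ?h x)"
    by (rule infsum_mono_neutral) (auto simp: h summable_ell2_fun)
  finally show "(\<Sum>\<^sub>\<infinity>x. ?k x) \<le> (\<Sum>\<^sub>\<infinity>x. ?h x)" .
qed

lemma left_translate_fun:
  assumes "g \<in> carrier G"
  shows "ell2_fun (left_translate G g f) =
    (\<lambda>x. if x \<in> carrier G then ell2_fun f (inv g \<otimes> x) else 0)"
  unfolding left_translate_def
  by (rule Abs_ell2_inverse) (use left_translate_summable(1)[OF assms] in simp)

lemma left_regular_apply:
  assumes g: "g \<in> carrier G"
  shows "ell2_fun (left_regular G g f) =
    (\<lambda>x. if x \<in> carrier G then ell2_fun f (inv g \<otimes> x) else 0)"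
proof -
  have "bounded_linear (left_translate G g)"
  proof (rule bounded_linear_intro)
    fix f h :: "'a ell2" and r :: real
    show "left_translate G g (f + h) = left_translate G g f + left_translate G g h"
      by (auto simp: ell2_fun_inject[symmetric] left_translate_fun[OF g] plus_ell2.rep_eq)
    show "left_translate G g (r *\<^sub>R f) = r *\<^sub>R left_translate G g f"
      by (auto simp: ell2_fun_inject[symmetric] left_translate_fun[OF g]
          scaleR_ell2_def ell2_scaleC.rep_eq)
    show "norm (left_translate G g f) \<le> norm f * 1"
      unfolding norm_ell2_def left_translate_fun[OF g]
      using left_translate_summable(2)[OF g] by simp
  qed
  then show ?thesis
    unfolding left_regular_def by (simp add: bounded_linear_Blinfun_apply left_translate_fun[OF g])
qed

end

text \<open>
  For \<open>H = carrier G\<close> this is the reduced C*-algebra of \<open>G\<close>. For a subgroup \<open>H\<close> it is the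
  canonical copy of the reduced C*-algebra of \<open>H\<close> inside that of \<open>G\<close>: as \<open>G\<close> is a disjoint
  union of right cosets of \<open>H\<close>, the restriction to \<open>H\<close> of the left regular representation of
  \<open>G\<close> is a multiple of that of \<open>H\<close>.
\<close>

definition reduced_cstar :: "('a, 'b) monoid_scheme \<Rightarrow> 'a set \<Rightarrow> 'a ell2_op set" where
  "reduced_cstar G H =
     closure {\<Sum>h\<in>F. op_scaleC (a h) (left_regular G h) | F a. finite F \<and> F \<subseteq> H}"

definition cstar_irreducible :: "('a, 'b) monoid_scheme \<Rightarrow> 'a set \<Rightarrow> bool" where
  "cstar_irreducible G H \<longleftrightarrow>
     group G \<and> subgroup H G \<and>
     (\<forall>B. cstar_algebra B \<and> reduced_cstar G H \<subseteq> B \<and> B \<subseteq> reduced_cstar G (carrier G)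
        \<longrightarrow> simple_cstar_algebra B)"

section \<open>The groups\<close>

definition GL_Q :: "nat \<Rightarrow> rat mat monoid" where
  "GL_Q n = units_of (ring_mat TYPE(rat) n ())"

definition scalars_GL_Q :: "nat \<Rightarrow> rat mat set" where
  "scalars_GL_Q n = {c \<cdot>\<^sub>m 1\<^sub>m n | c. True} \<inter> carrier (GL_Q n)"

definition PGL_Q :: "nat \<Rightarrow> rat mat set monoid" where
  "PGL_Q n = GL_Q n Mod scalars_GL_Q n"

definition SL_Z :: "nat \<Rightarrow> int mat monoid" where
  "SL_Z n = \<lparr>carrier = {A \<in> carrier_mat n n. det A = 1}, mult = (*), one = 1\<^sub>m n\<rparr>"

definition scalars_SL_Z :: "nat \<Rightarrow> int mat set" where
  "scalars_SL_Z n = {c \<cdot>\<^sub>m 1\<^sub>m n | c. True} \<inter> carrier (SL_Z n)"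

definition PSL_Z :: "nat \<Rightarrow> int mat set monoid" where
  "PSL_Z n = SL_Z n Mod scalars_SL_Z n"

text \<open>The coset of \<open>A\<close> is sent to the coset of \<open>A\<close> viewed as a rational matrix.\<close>

definition PSL_to_PGL :: "nat \<Rightarrow> int mat set \<Rightarrow> rat mat set" where
  "PSL_to_PGL n C = scalars_GL_Q n <#>\<^bsub>GL_Q n\<^esub> map_mat rat_of_int ` C"

lemma carrier_GL_Q: "carrier (GL_Q n) = {A \<in> carrier_mat n n. det A \<noteq> 0}"
proof -
  have "A \<in> Units (ring_mat TYPE(rat) n ()) \<longleftrightarrow> A \<in> carrier_mat n n \<and> det A \<noteq> 0" for A
    using det_non_zero_imp_unit[of A n "()"] unit_imp_det_non_zero[of A n "()"]
    by (auto simp: Units_def ring_mat_simps)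
  then show ?thesis by (auto simp: GL_Q_def units_of_carrier)
qed

lemma mult_GL_Q [simp]: "mult (GL_Q n) = (*)"
  by (simp add: GL_Q_def units_of_mult ring_mat_simps)

lemma one_GL_Q [simp]: "one (GL_Q n) = 1\<^sub>m n"
  by (simp add: GL_Q_def units_of_one ring_mat_simps)

lemma group_GL_Q: "group (GL_Q n)"
  unfolding GL_Q_def using ring.is_monoid[OF ring_mat] by (rule monoid.units_group)

lemma scalar_mat_mult:
  fixes A :: "'a :: comm_ring_1 mat"
  assumes "A \<in> carrier_mat n n"
  shows "(c \<cdot>\<^sub>m 1\<^sub>m n) * A = c \<cdot>\<^sub>m A" and "A * (c \<cdot>\<^sub>m 1\<^sub>m n) = c \<cdot>\<^sub>m A"
  using assms mult_smult_distrib[OF assms one_carrier_mat, of c]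
  by (simp_all add: mult_smult_assoc_mat[OF one_carrier_mat assms])

lemma PSL_to_PGL_coset:
  assumes A: "A \<in> carrier (SL_Z n)"
  shows "PSL_to_PGL n (scalars_SL_Z n #>\<^bsub>SL_Z n\<^esub> A) =
    scalars_GL_Q n #>\<^bsub>GL_Q n\<^esub> map_mat rat_of_int A"
proof -
  interpret G: group "GL_Q n" by (rule group_GL_Q)
  have AG: "map_mat rat_of_int B \<in> carrier (GL_Q n)" if "B \<in> carrier (SL_Z n)" for B
    using that by (auto simp: SL_Z_def carrier_GL_Q of_int_hom.hom_det)
  have A': "A \<in> carrier_mat n n" using A by (simp add: SL_Z_def)
  show ?thesis
  proof (intro equalityI subsetI)
    fix X assume "X \<in> PSL_to_PGL n (scalars_SL_Z n #>\<^bsub>SL_Z n\<^esub> A)"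
    then obtain s t where s: "s \<cdot>\<^sub>m 1\<^sub>m n \<in> carrier (GL_Q n)" and t: "t \<cdot>\<^sub>m 1\<^sub>m n \<in> carrier (SL_Z n)"
      and X: "X = (s \<cdot>\<^sub>m 1\<^sub>m n) * map_mat rat_of_int ((t \<cdot>\<^sub>m 1\<^sub>m n) * A)"
      by (auto simp: PSL_to_PGL_def set_mult_def r_coset_def scalars_GL_Q_def scalars_SL_Z_def SL_Z_def)
    have "map_mat rat_of_int (t \<cdot>\<^sub>m 1\<^sub>m n) = rat_of_int t \<cdot>\<^sub>m 1\<^sub>m n"
      by (rule eq_matI) auto
    then have tG: "rat_of_int t \<cdot>\<^sub>m 1\<^sub>m n \<in> carrier (GL_Q n)" using AG[OF t] by simp
    have "X = (s * rat_of_int t) \<cdot>\<^sub>m map_mat rat_of_int A"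
      unfolding X using A' by (auto simp: scalar_mat_mult intro!: eq_matI)
    moreover have "(s * rat_of_int t) \<cdot>\<^sub>m 1\<^sub>m n \<in> carrier (GL_Q n)"
    proof -
      have "(s \<cdot>\<^sub>m 1\<^sub>m n) * (rat_of_int t \<cdot>\<^sub>m 1\<^sub>m n) = (s * rat_of_int t) \<cdot>\<^sub>m 1\<^sub>m n"
        by (subst scalar_mat_mult(1)) (auto intro!: eq_matI)
      with G.m_closed[OF s tG] show ?thesis by simp
    qed
    ultimately show "X \<in> scalars_GL_Q n #>\<^bsub>GL_Q n\<^esub> map_mat rat_of_int A"
      using A' by (auto simp: r_coset_def scalars_GL_Q_def scalar_mat_mult
          intro!: bexI[of _ "(s * rat_of_int t) \<cdot>\<^sub>m 1\<^sub>m n"])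
  next
    fix X assume "X \<in> scalars_GL_Q n #>\<^bsub>GL_Q n\<^esub> map_mat rat_of_int A"
    then obtain S where "S \<in> scalars_GL_Q n" "X = S * map_mat rat_of_int A"
      by (auto simp: r_coset_def)
    moreover have "A \<in> scalars_SL_Z n #>\<^bsub>SL_Z n\<^esub> A"
      using A' by (auto simp: r_coset_def scalars_SL_Z_def SL_Z_def scalar_mat_mult
          intro!: bexI[of _ "1\<^sub>m n"] exI[of _ 1] eq_matI)
    ultimately show "X \<in> PSL_to_PGL n (scalars_SL_Z n #>\<^bsub>SL_Z n\<^esub> A)"
      by (auto simp: PSL_to_PGL_def set_mult_def)
  qed
qed

end

theory Submission
  imports Defs "HOL-Analysis.Convex" "HOL-Computational_Algebra.Fundamental_Theorem_Algebra"
begin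

text \<open>
  Powers' averaging reduces the statement to dynamics. Let \<open>F\<close> be a finite set of nontrivial
  elements of \<open>\<Gamma>\<close>, and suppose that there are \<open>U \<subseteq> \<Gamma>\<close> with \<open>g U \<inter> U = {}\<close> for \<open>g \<in> F\<close> and
  \<open>k\<^sub>0, k\<^sub>1, \<dots> \<in> \<Lambda>\<close> such that each \<open>x \<in> \<Gamma>\<close> satisfies \<open>k\<^sub>j x \<notin> U\<close> for at most \<open>K\<close> indices. By
  Cauchy-Schwarz, averaging the conjugates \<open>k\<^sub>j\<^sup>-\<^sup>1 g k\<^sub>j\<close> over \<open>N\<close> indices gives norm at most
  \<open>2 (K / N)\<^sup>1\<^sup>/\<^sup>2\<close>. So averages over \<open>\<Lambda>\<close> of an element \<open>x\<close> of an ideal of an intermediate algebra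
  converge to \<open>\<tau>(x) 1\<close>, and \<open>\<tau>(x x\<^sup>*) > 0\<close> unless \<open>x = 0\<close>.

  For \<open>PGL(n, \<rat>)\<close> the set \<open>U\<close> is pulled back from a small neighbourhood of a rational line not
  fixed by any element of \<open>F\<close>, and the \<open>k\<^sub>j\<close> come from a regular unipotent one-parameter group,
  acting on polynomials of degree less than \<open>n\<close> by translations. A translate \<open>P(x + c)\<close> is close
  to the line of constants unless \<open>c\<close> is close to one of the at most \<open>n - 1\<close> complex roots of \<open>P\<close>;
  taking \<open>c\<close> in a sparse arithmetic progression yields \<open>K = n\<close>.
\<close>

section \<open>Operators on square-summable functions\<close>

lemma norm_ell2_squared: "(norm f)\<^sup>2 = (\<Sum>\<^sub>\<infinity>x. (cmod (ell2_fun f x))\<^sup>2)"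
  unfolding norm_ell2_def by (simp add: infsum_nonneg)

lemma cmod_ell2_fun_le_norm: "cmod (ell2_fun f x) \<le> norm f"
proof -
  have "(\<Sum>\<^sub>\<infinity>y\<in>{x}. (cmod (ell2_fun f y))\<^sup>2) \<le> (\<Sum>\<^sub>\<infinity>y. (cmod (ell2_fun f y))\<^sup>2)"
    by (rule infsum_mono_neutral) (auto simp: summable_ell2_fun)
  then have "(cmod (ell2_fun f x))\<^sup>2 \<le> (norm f)\<^sup>2"
    by (simp add: norm_ell2_squared)
  then show ?thesis by (rule power2_le_imp_le) simp
qed

lemma bounded_linear_ell2_fun: "bounded_linear (\<lambda>f. ell2_fun f x)"
proof (rule bounded_linear_intro)
  fix f g :: "'a ell2" and r :: real
  show "ell2_fun (f + g) x = ell2_fun f x + ell2_fun g x" by (simp add: plus_ell2.rep_eq)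
  show "ell2_fun (r *\<^sub>R f) x = r *\<^sub>R ell2_fun f x"
    by (simp add: scaleR_ell2_def ell2_scaleC.rep_eq scaleR_conv_of_real)
  show "cmod (ell2_fun f x) \<le> norm f * 1" by (simp add: cmod_ell2_fun_le_norm)
qed

lemmas ell2_fun_sum = linear_sum[OF bounded_linear.linear[OF bounded_linear_ell2_fun]]

text \<open>Matrix coefficients depend continuously on the operator, so an identity between them is
  a closed condition and passes from finite sums of translations to the whole reduced
  C*-algebra.\<close>

lemma bounded_linear_ell2_coeff: "bounded_linear (\<lambda>T :: 'a ell2_op. ell2_fun (T f) x)"
  by (intro bounded_linear_compose[OF bounded_linear_ell2_fun]
      bounded_linear_compose[OF bounded_bilinear.bounded_linear_left[OF bounded_bilinear_blinfun_apply]]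
      bounded_linear_ident)

lemmas continuous_on_ell2_coeff = bounded_linear.continuous_on[OF bounded_linear_ell2_coeff]

section \<open>Point masses and restrictions to subsets\<close>

lift_definition ell2_delta :: "'a \<Rightarrow> 'a ell2" is "\<lambda>a x. if x = a then 1 else 0"
proof -
  fix a :: 'a
  have "(\<lambda>x. (cmod (if x = a then 1 else 0 :: complex))\<^sup>2) summable_on {a}" by simp
  also have "?this \<longleftrightarrow> (\<lambda>x. (cmod (if x = a then 1 else 0 :: complex))\<^sup>2) summable_on UNIV"
    by (rule summable_on_cong_neutral) auto
  finally show "(\<lambda>x. (cmod (if x = a then 1 else 0))\<^sup>2) summable_on (UNIV :: 'a set)" .
qed

lemma norm_ell2_delta: "norm (ell2_delta a) = 1"
proof -
  have "(\<Sum>\<^sub>\<infinity>x. (cmod (ell2_fun (ell2_delta a) x))\<^sup>2)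
      = (\<Sum>\<^sub>\<infinity>x\<in>{a}. (cmod (ell2_fun (ell2_delta a) x))\<^sup>2)"
    by (rule infsum_cong_neutral) (auto simp: ell2_delta.rep_eq)
  then show ?thesis by (simp add: norm_ell2_def ell2_delta.rep_eq)
qed

lemma ell2_cinner_delta: "ell2_cinner f (ell2_delta a) = ell2_fun f a"
proof -
  have "ell2_cinner f (ell2_delta a)
      = (\<Sum>\<^sub>\<infinity>x\<in>{a}. ell2_fun f x * cnj (ell2_fun (ell2_delta a) x))"
    unfolding ell2_cinner_def by (rule infsum_cong_neutral) (auto simp: ell2_delta.rep_eq)
  then show ?thesis by (simp add: ell2_delta.rep_eq)
qed

lift_definition ell2_restrict :: "'a set \<Rightarrow> 'a ell2 \<Rightarrow> 'a ell2" is
  "\<lambda>S f x. if x \<in> S then f x else 0"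
proof -
  fix S :: "'a set" and f :: "'a \<Rightarrow> complex"
  assume "(\<lambda>x. (cmod (f x))\<^sup>2) summable_on UNIV"
  then show "(\<lambda>x. (cmod (if x \<in> S then f x else 0))\<^sup>2) summable_on UNIV"
    by (rule summable_on_comparison_test) auto
qed

lemma norm_ell2_restrict_le: "norm (ell2_restrict S f) \<le> norm f"
  unfolding norm_ell2_def
  by (intro real_sqrt_le_mono infsum_mono summable_ell2_fun) (auto simp: ell2_restrict.rep_eq)

lemma ell2_restrict_add_compl: "ell2_restrict S f + ell2_restrict (- S) f = f"
  by (auto simp: ell2_fun_inject[symmetric] plus_ell2.rep_eq ell2_restrict.rep_eq)

lemma inner_ell2_disjoint:
  assumes "\<And>x. ell2_fun f x = 0 \<or> ell2_fun g x = 0"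
  shows "inner f g = 0"
proof -
  have "ell2_fun f x * cnj (ell2_fun g x) = 0" for x using assms[of x] by auto
  then have "(\<lambda>x. ell2_fun f x * cnj (ell2_fun g x)) = (\<lambda>_. 0)" by (intro ext)
  then show ?thesis by (simp add: inner_ell2_def ell2_cinner_def)
qed

lemma has_sum_finite_sum:
  fixes f :: "'i \<Rightarrow> 'a \<Rightarrow> 'b :: topological_comm_monoid_add"
  assumes "\<And>i. i \<in> I \<Longrightarrow> (f i has_sum s i) A"
  shows "((\<lambda>x. \<Sum>i\<in>I. f i x) has_sum (\<Sum>i\<in>I. s i)) A"
  using assms
proof (induction I rule: infinite_finite_induct)
  case (insert i I)
  then show ?case by (simp add: has_sum_add)
qed auto

text \<open>After interchanging the sums, a point \<open>x\<close> contributes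
  \<open>(cmod (ell2_fun f x))\<^sup>2\<close> once for every \<open>j < N\<close> with
  \<open>x \<in> S j\<close>, hence at most \<open>K\<close> times.\<close>

lemma sum_norm_ell2_restrict_le:
  fixes S :: "nat \<Rightarrow> 'a set"
  assumes "\<And>x. card {j. j < N \<and> x \<in> S j} \<le> K"
  shows "(\<Sum>j<N. (norm (ell2_restrict (S j) f))\<^sup>2) \<le> real K * (norm f)\<^sup>2"
proof -
  let ?h = "\<lambda>j x. (cmod (ell2_fun (ell2_restrict (S j) f) x))\<^sup>2"
  have has_sum: "((\<lambda>x. \<Sum>j<N. ?h j x) has_sum (\<Sum>j<N. \<Sum>\<^sub>\<infinity>x. ?h j x)) UNIV"
    by (intro has_sum_finite_sum has_sum_infsum summable_ell2_fun)
  have "(\<Sum>j<N. (norm (ell2_restrict (S j) f))\<^sup>2) = (\<Sum>j<N. \<Sum>\<^sub>\<infinity>x. ?h j x)"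
    by (simp add: norm_ell2_squared)
  also have "\<dots> = (\<Sum>\<^sub>\<infinity>x. \<Sum>j<N. ?h j x)"
    by (rule infsumI[OF has_sum, symmetric])
  also have "\<dots> \<le> (\<Sum>\<^sub>\<infinity>x. real K * (cmod (ell2_fun f x))\<^sup>2)"
  proof (rule infsum_mono)
    show "(\<lambda>x. \<Sum>j<N. ?h j x) summable_on UNIV"
      using has_sum by (rule has_sum_imp_summable)
    show "(\<lambda>x. real K * (cmod (ell2_fun f x))\<^sup>2) summable_on UNIV"
      by (intro summable_on_cmult_right summable_ell2_fun)
    fix x
    have "(\<Sum>j<N. ?h j x) = (\<Sum>j\<in>{j. j < N \<and> x \<in> S j}. (cmod (ell2_fun f x))\<^sup>2)"
      by (rule sum.mono_neutral_cong_right) (auto simp: ell2_restrict.rep_eq)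
    also have "\<dots> = real (card {j. j < N \<and> x \<in> S j}) * (cmod (ell2_fun f x))\<^sup>2" by simp
    also have "\<dots> \<le> real K * (cmod (ell2_fun f x))\<^sup>2"
      using assms[of x] by (intro mult_right_mono) auto
    finally show "(\<Sum>j<N. ?h j x) \<le> real K * (cmod (ell2_fun f x))\<^sup>2" .
  qed
  also have "\<dots> = real K * (norm f)\<^sup>2"
    by (simp add: norm_ell2_squared infsum_cmult_right summable_ell2_fun)
  finally show ?thesis .
qed

section \<open>Complex multiples of operators\<close>

lemma ell2_fun_op_scaleC: "ell2_fun (op_scaleC c T f) x = c * ell2_fun (T f) x"
  by (simp add: op_scaleC_apply ell2_scaleC.rep_eq)

lemma blinfun_ell2_eqI:
  fixes S T :: "'a ell2_op"
  assumes "\<And>f x. ell2_fun (S f) x = ell2_fun (T f) x"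
  shows "S = T"
  by (intro blinfun_eqI) (auto simp: ell2_fun_inject[symmetric] assms)

lemma scaleR_conv_op_scaleC: "r *\<^sub>R T = op_scaleC (of_real r) T"
  by (intro blinfun_eqI) (simp add: op_scaleC_apply scaleR_blinfun.rep_eq scaleR_ell2_def)

lemma norm_op_scaleC_le: "norm (op_scaleC c T) \<le> cmod c * norm T"
proof (rule norm_blinfun_bound)
  fix f
  show "norm (op_scaleC c T f) \<le> cmod c * norm T * norm f"
    by (simp add: op_scaleC_apply norm_ell2_scaleC mult.assoc mult_left_mono norm_blinfun)
qed simp

lemma op_scaleC_diff: "op_scaleC (a - b) T = op_scaleC a T - op_scaleC b T"
  by (intro blinfun_ell2_eqI)
    (simp add: ell2_fun_op_scaleC blinfun.diff_left algebra_simps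
      linear_diff[OF bounded_linear.linear[OF bounded_linear_ell2_fun]])

lemma op_scaleC_op_scaleC: "op_scaleC a (op_scaleC b T) = op_scaleC (a * b) T"
  by (intro blinfun_ell2_eqI) (simp add: ell2_fun_op_scaleC)

lemma op_scaleC_comp_left: "op_scaleC c S o\<^sub>L T = op_scaleC c (S o\<^sub>L T)"
  by (intro blinfun_ell2_eqI) (simp add: ell2_fun_op_scaleC)

lemma op_scaleC_one: "op_scaleC 1 T = T"
  by (intro blinfun_ell2_eqI) (simp add: ell2_fun_op_scaleC)

lemma complex_subspace_sum:
  assumes "complex_subspace B" and "\<And>i. i \<in> A \<Longrightarrow> T i \<in> B"
  shows "(\<Sum>i\<in>A. T i) \<in> B"
  using assms(2)
proof (induction A rule: infinite_finite_induct)
  case (insert x A)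
  then have "T x \<in> B" "(\<Sum>i\<in>A. T i) \<in> B" by auto
  with insert.hyps show ?case using assms(1) by (simp add: complex_subspace_def)
qed (use assms(1) in \<open>auto simp: complex_subspace_def\<close>)

section \<open>The left regular representation\<close>

text \<open>A closure is the least closed superset, so a closed property has to be checked only on
  finite combinations of translations.\<close>

lemma reduced_cstar_induct [consumes 1, case_names closed sum]:
  assumes "T \<in> reduced_cstar G H"
    and "closed {T. P T}"
    and "\<And>F a. finite F \<Longrightarrow> F \<subseteq> H \<Longrightarrow> P (\<Sum>h\<in>F. op_scaleC (a h) (left_regular G h))"
  shows "P T"
proof -
  have "reduced_cstar G H \<subseteq> {T. P T}"
    unfolding reduced_cstar_def by (rule closure_minimal) (use assms(2,3) in auto)
  then show ?thesis using assms(1) by auto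
qed

lemma left_regular_in_reduced_cstar:
  assumes "h \<in> H"
  shows "left_regular G h \<in> reduced_cstar G H"
proof -
  have "left_regular G h = (\<Sum>g\<in>{h}. op_scaleC 1 (left_regular G g))"
    by (simp add: op_scaleC_one)
  then have "left_regular G h \<in>
      {\<Sum>h\<in>F. op_scaleC (a h) (left_regular G h) | F a. finite F \<and> F \<subseteq> H}"
    using assms by (intro CollectI exI[of _ "{h}"] exI[of _ "\<lambda>_. 1"]) auto
  then show ?thesis unfolding reduced_cstar_def by (rule subsetD[OF closure_subset])
qed

context group
begin

lemma norm_left_regular_apply_le:
  assumes "g \<in> carrier G"
  shows "norm (left_regular G g f) \<le> norm f"
  unfolding norm_ell2_def left_regular_apply[OF assms]
  using left_translate_summable(2)[OF assms] by simp

lemma norm_left_regular_le: "g \<in> carrier G \<Longrightarrow> norm (left_regular G g) \<le> 1"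
  by (rule norm_blinfun_bound) (simp_all add: norm_left_regular_apply_le)

lemma left_regular_mult:
  assumes "g \<in> carrier G" "h \<in> carrier G"
  shows "left_regular G g o\<^sub>L left_regular G h = left_regular G (g \<otimes> h)"
  using assms
  by (intro blinfun_ell2_eqI) (simp add: left_regular_apply inv_mult_group m_assoc)

lemma left_regular_delta:
  assumes "g \<in> carrier G" "y \<in> carrier G"
  shows "left_regular G g (ell2_delta y) = ell2_delta (g \<otimes> y)"
proof -
  have "inv g \<otimes> x = y \<longleftrightarrow> x = g \<otimes> y" if "x \<in> carrier G" for x
    using assms that by (metis inv_closed inv_solve_left')
  then show ?thesis
    using assms by (auto simp: ell2_fun_inject[symmetric] left_regular_apply ell2_delta.rep_eq)
qed

text \<open>On the type \<open>'a ell2\<close> the operator \<open>left_regular G \<one>\<close> is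
  the projection onto the functions supported on \<open>carrier G\<close>, which need not be the
  identity. It is nevertheless the unit of the algebras considered here.\<close>

lemma reduced_cstar_comp_one:
  assumes "T \<in> reduced_cstar G (carrier G)"
  shows "T o\<^sub>L left_regular G \<one> = T"
  using assms
proof (induction rule: reduced_cstar_induct)
  case closed
  show ?case
    by (intro closed_Collect_eq continuous_intros bounded_linear.continuous_on[OF bounded_bilinear.bounded_linear_left[OF bounded_bilinear_blinfun_compose]])
next
  case (sum F a)
  have "op_scaleC (a g) (left_regular G g) o\<^sub>L left_regular G \<one> = op_scaleC (a g) (left_regular G g)"
    if "g \<in> F" for g
  proof -
    have "g \<in> carrier G" using that sum by auto
    then show ?thesis
      using left_regular_mult[of g \<one>] by (simp add: op_scaleC_comp_left)
  qed
  then show ?case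
    by (simp add: bounded_bilinear.sum_left[OF bounded_bilinear_blinfun_compose])
qed

lemma reduced_cstar_off_carrier:
  assumes "T \<in> reduced_cstar G (carrier G)" and "x \<notin> carrier G"
  shows "ell2_fun (T f) x = 0"
  using assms(1)
proof (induction rule: reduced_cstar_induct)
  case closed
  show ?case by (intro closed_Collect_eq continuous_on_ell2_coeff continuous_intros)
next
  case (sum F a)
  have "ell2_fun (left_regular G g f) x = 0" if "g \<in> F" for g
    using that sum assms(2) by (subst left_regular_apply) auto
  then show ?case by (simp add: blinfun.sum_left ell2_fun_sum ell2_fun_op_scaleC)
qed

text \<open>Left translations commute with right translations, so the matrix of \<open>T\<close>
  depends only on \<open>x \<otimes> inv y\<close>. Hence the single vector
  \<open>T (ell2_delta \<one>)\<close> determines \<open>T\<close> on all point masses of the group,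
  which makes the trace faithful.\<close>

lemma reduced_cstar_right_invariant:
  assumes "T \<in> reduced_cstar G (carrier G)" and "x \<in> carrier G" "y \<in> carrier G"
  shows "ell2_fun (T (ell2_delta y)) x = ell2_fun (T (ell2_delta \<one>)) (x \<otimes> inv y)"
  using assms(1)
proof (induction rule: reduced_cstar_induct)
  case closed
  show ?case by (intro closed_Collect_eq continuous_on_ell2_coeff continuous_intros)
next
  case (sum F a)
  have "ell2_fun (left_regular G g (ell2_delta y)) x
      = ell2_fun (left_regular G g (ell2_delta \<one>)) (x \<otimes> inv y)" if "g \<in> F" for g
  proof -
    have g: "g \<in> carrier G" using that sum by auto
    have "x = g \<otimes> y \<longleftrightarrow> x \<otimes> inv y = g"
      using g assms(2,3) by (metis inv_closed inv_solve_right m_closed)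
    then show ?thesis using g assms(2,3) by (simp add: left_regular_delta ell2_delta.rep_eq)
  qed
  then show ?case by (simp add: blinfun.sum_left ell2_fun_sum ell2_fun_op_scaleC)
qed

subsection \<open>Powers averaging\<close>

text \<open>Split \<open>f\<close> and \<open>h\<close> into their parts on and off
  \<open>S\<close>. As \<open>g\<close> maps the complement of \<open>S\<close> into
  \<open>S\<close>, the translate of the part of \<open>f\<close> off \<open>S\<close> is orthogonal
  to the part of \<open>h\<close> off \<open>S\<close>. Cauchy-Schwarz bounds the other terms, each
  of which contains a restriction to \<open>S\<close>.\<close>

lemma inner_left_regular_le:
  assumes g: "g \<in> carrier G" and S: "\<And>x. x \<in> carrier G \<Longrightarrow> x \<notin> S \<Longrightarrow> g \<otimes> x \<in> S"
  shows "inner (left_regular G g f) h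
    \<le> norm f * norm (ell2_restrict S h) + norm (ell2_restrict S f) * norm h"
proof -
  let ?L = "left_regular G g" and ?R = "ell2_restrict S" and ?Q = "ell2_restrict (- S)"
  have split: "inner (?L f) h = inner (?L (?R f)) h + inner (?L (?Q f)) (?R h) + inner (?L (?Q f)) (?Q h)"
    by (simp add: ell2_restrict_add_compl blinfun.add_right[symmetric]
        inner_add_left[symmetric] inner_add_right[symmetric] add.assoc)
  have "inner (?L (?Q f)) (?Q h) = 0"
  proof (rule inner_ell2_disjoint)
    fix x
    have "inv g \<otimes> x \<in> S" if "x \<in> carrier G" "x \<notin> S"
    proof (rule ccontr)
      assume "inv g \<otimes> x \<notin> S"
      then have "g \<otimes> (inv g \<otimes> x) \<in> S" using S g that by simp
      then show False using g that by (simp add: m_assoc[symmetric])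
    qed
    then show "ell2_fun (?L (?Q f)) x = 0 \<or> ell2_fun (?Q h) x = 0"
      by (auto simp: left_regular_apply[OF g] ell2_restrict.rep_eq)
  qed
  moreover have "inner (?L (?Q f)) (?R h) \<le> norm f * norm (?R h)"
  proof -
    have "norm (?L (?Q f)) \<le> norm f"
      using norm_left_regular_apply_le[OF g] norm_ell2_restrict_le order_trans by blast
    then show ?thesis
      using norm_cauchy_schwarz[of "?L (?Q f)" "?R h"] mult_right_mono[OF _ norm_ge_zero]
      by (meson order_trans)
  qed
  moreover have "inner (?L (?R f)) h \<le> norm (?R f) * norm h"
    using norm_cauchy_schwarz[of "?L (?R f)" h]
      mult_right_mono[OF norm_left_regular_apply_le[OF g, of "?R f"] norm_ge_zero[of h]]
    by linarith
  ultimately show ?thesis using split by linarith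
qed

text \<open>The triangle inequality alone would give \<open>N\<close>. The gain comes from applying
  \<open>inner_left_regular_le\<close> with a different set for each \<open>j\<close>: every
  \<open>x\<close> lies in at most \<open>K\<close> of these sets, so their restrictions are nearly
  orthogonal.\<close>

lemma norm_sum_conj_le:
  fixes k :: "nat \<Rightarrow> 'a"
  assumes g: "g \<in> carrier G" and gU: "\<And>x. x \<in> U \<Longrightarrow> g \<otimes> x \<notin> U"
    and k: "\<And>j. k j \<in> carrier G"
    and K: "\<And>x. x \<in> carrier G \<Longrightarrow> card {j. j < N \<and> k j \<otimes> x \<notin> U} \<le> K"
  shows "norm (\<Sum>j<N. left_regular G (inv (k j) \<otimes> g \<otimes> k j)) \<le> 2 * sqrt (real K * real N)"
proof (rule norm_blinfun_bound)
  let ?T = "\<Sum>j<N. left_regular G (inv (k j) \<otimes> g \<otimes> k j)"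
  \<comment> \<open>\<open>S j\<close> is the complement of the preimage of \<open>U\<close> under
    \<open>k j\<close>. Off \<open>S j\<close> the point \<open>k j \<otimes> x\<close> lies in
    \<open>U\<close>, so \<open>g\<close> moves it out of \<open>U\<close>, and the conjugate of
    \<open>g\<close> moves \<open>x\<close> into \<open>S j\<close>.\<close>
  define S where "S j = {x \<in> carrier G. k j \<otimes> x \<notin> U}" for j
  have card_S: "card {j. j < N \<and> x \<in> S j} \<le> K" for x
    using K[of x] by (cases "x \<in> carrier G") (auto simp: S_def)
  have sum_S: "(\<Sum>j<N. norm (ell2_restrict (S j) h)) \<le> sqrt (real K * real N) * norm h" for h
  proof -
    have "(\<Sum>j<N. norm (ell2_restrict (S j) h))\<^sup>2
        \<le> (\<Sum>j<N. (norm (ell2_restrict (S j) h))\<^sup>2) * real N"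
      using sum_squared_le_sum_of_squares[of "\<lambda>j. norm (ell2_restrict (S j) h)" "{..<N}"] by simp
    also have "\<dots> \<le> (real K * (norm h)\<^sup>2) * real N"
      using sum_norm_ell2_restrict_le[OF card_S] by (simp add: mult_right_mono)
    also have "\<dots> = (sqrt (real K * real N) * norm h)\<^sup>2"
      by (simp add: power_mult_distrib)
    finally show ?thesis by (rule power2_le_imp_le) simp
  qed
  fix f
  have le: "inner (left_regular G (inv (k j) \<otimes> g \<otimes> k j) f) h
      \<le> norm f * norm (ell2_restrict (S j) h) + norm (ell2_restrict (S j) f) * norm h" for j h
  proof (rule inner_left_regular_le)
    fix x assume x: "x \<in> carrier G" "x \<notin> S j"
    have "k j \<otimes> (inv (k j) \<otimes> y) = y" if "y \<in> carrier G" for y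
      using that k by (simp add: m_assoc[symmetric])
    then have "k j \<otimes> (inv (k j) \<otimes> g \<otimes> k j \<otimes> x) = g \<otimes> (k j \<otimes> x)"
      using x k g by (simp add: m_assoc)
    then show "inv (k j) \<otimes> g \<otimes> k j \<otimes> x \<in> S j" using x k g gU by (simp add: S_def)
  qed (simp add: k g)
  \<comment> \<open>Testing against \<open>?T f\<close> itself turns the estimates of inner products
    into a bound on the norm, after division by \<open>norm (?T f)\<close>.\<close>
  have "inner (?T f) (?T f) = (\<Sum>j<N. inner (left_regular G (inv (k j) \<otimes> g \<otimes> k j) f) (?T f))"
    by (simp add: blinfun.sum_left inner_sum_left)
  also have "\<dots> \<le> (\<Sum>j<N. norm f * norm (ell2_restrict (S j) (?T f))
      + norm (ell2_restrict (S j) f) * norm (?T f))"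
    by (intro sum_mono le)
  also have "\<dots> = norm f * (\<Sum>j<N. norm (ell2_restrict (S j) (?T f)))
      + (\<Sum>j<N. norm (ell2_restrict (S j) f)) * norm (?T f)"
    by (simp add: sum.distrib sum_distrib_left sum_distrib_right)
  also have "\<dots> \<le> norm f * (sqrt (real K * real N) * norm (?T f))
      + (sqrt (real K * real N) * norm f) * norm (?T f)"
    by (intro add_mono mult_left_mono mult_right_mono sum_S) auto
  finally have "norm (?T f) * norm (?T f) \<le> (2 * sqrt (real K * real N) * norm f) * norm (?T f)"
    by (simp add: power2_norm_eq_inner[symmetric] power2_eq_square algebra_simps)
  then show "norm (?T f) \<le> 2 * sqrt (real K * real N) * norm f"
    by (cases "norm (?T f) = 0") auto
qed simp

definition conj_average :: "(nat \<Rightarrow> 'a) \<Rightarrow> nat \<Rightarrow> 'a ell2_op \<Rightarrow> 'a ell2_op" where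
  "conj_average k N T = inverse (real N) *\<^sub>R
     (\<Sum>j<N. left_regular G (inv (k j)) o\<^sub>L T o\<^sub>L left_regular G (k j))"

lemma ell2_fun_conj_average:
  assumes "\<And>j. k j \<in> carrier G"
  shows "ell2_fun (conj_average k N T f) x = (if x \<in> carrier G then
    inverse (of_nat N) * (\<Sum>j<N. ell2_fun (T (left_regular G (k j) f)) (k j \<otimes> x)) else 0)"
  using assms
  by (simp add: conj_average_def scaleR_conv_op_scaleC ell2_fun_op_scaleC blinfun.sum_left
      ell2_fun_sum left_regular_apply)

lemma conj_average_sum:
  assumes "\<And>j. k j \<in> carrier G"
  shows "conj_average k N (\<Sum>i\<in>I. op_scaleC (a i) (T i)) = (\<Sum>i\<in>I. op_scaleC (a i) (conj_average k N (T i)))"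
proof (rule blinfun_ell2_eqI)
  fix f x
  have "(\<Sum>j<N. \<Sum>i\<in>I. a i * ell2_fun (T i (left_regular G (k j) f)) (k j \<otimes> x))
      = (\<Sum>i\<in>I. a i * (\<Sum>j<N. ell2_fun (T i (left_regular G (k j) f)) (k j \<otimes> x)))"
    by (subst sum.swap) (simp add: sum_distrib_left)
  then show "ell2_fun (conj_average k N (\<Sum>i\<in>I. op_scaleC (a i) (T i)) f) x
      = ell2_fun ((\<Sum>i\<in>I. op_scaleC (a i) (conj_average k N (T i))) f) x"
    by (simp add: ell2_fun_conj_average[OF assms] blinfun.sum_left ell2_fun_sum ell2_fun_op_scaleC
        sum_distrib_left mult_ac)
qed

lemma conj_average_diff:
  assumes "\<And>j. k j \<in> carrier G"
  shows "conj_average k N (S - T) = conj_average k N S - conj_average k N T"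
  by (intro blinfun_ell2_eqI)
    (simp add: ell2_fun_conj_average[OF assms] blinfun.diff_left sum_subtractf right_diff_distrib
      linear_diff[OF bounded_linear.linear[OF bounded_linear_ell2_fun]])

lemma norm_conj_average_le:
  assumes k: "\<And>j. k j \<in> carrier G" and N: "N > 0"
  shows "norm (conj_average k N T) \<le> norm T"
proof -
  have le: "norm (left_regular G (inv (k j)) o\<^sub>L T o\<^sub>L left_regular G (k j)) \<le> norm T" for j
  proof (rule norm_blinfun_bound)
    fix f
    have "norm (left_regular G (inv (k j)) (T (left_regular G (k j) f)))
        \<le> norm (T (left_regular G (k j) f))"
      using k by (intro norm_left_regular_apply_le) simp
    also have "\<dots> \<le> norm T * norm (left_regular G (k j) f)" by (rule norm_blinfun)
    also have "\<dots> \<le> norm T * norm f"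
      using k by (intro mult_left_mono norm_left_regular_apply_le) auto
    finally show "norm ((left_regular G (inv (k j)) o\<^sub>L T o\<^sub>L left_regular G (k j)) f) \<le> norm T * norm f"
      by simp
  qed simp
  have "norm (\<Sum>j<N. left_regular G (inv (k j)) o\<^sub>L T o\<^sub>L left_regular G (k j)) \<le> (\<Sum>j<N. norm T)"
    by (intro sum_norm_le le)
  then show ?thesis using N by (simp add: conj_average_def divide_simps mult.commute)
qed

lemma conj_average_left_regular:
  assumes "\<And>j. k j \<in> carrier G" "g \<in> carrier G"
  shows "conj_average k N (left_regular G g)
    = inverse (real N) *\<^sub>R (\<Sum>j<N. left_regular G (inv (k j) \<otimes> g \<otimes> k j))"
  using assms by (simp add: conj_average_def left_regular_mult)

text \<open>The conjugators are drawn from \<open>H\<close> for the sake of this lemma: their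
  translations lie in every intermediate algebra, so averaging never leaves an ideal of it.\<close>

lemma conj_average_in_ideal:
  assumes I: "closed_two_sided_ideal I B" and B: "reduced_cstar G H \<subseteq> B" "subgroup H G"
    and k: "range k \<subseteq> H" and T: "T \<in> I"
  shows "conj_average k N T \<in> I"
proof -
  have "left_regular G h \<in> B" if "h \<in> H" for h
    using left_regular_in_reduced_cstar[OF that] B by blast
  then have "left_regular G (inv (k j)) o\<^sub>L T o\<^sub>L left_regular G (k j) \<in> I" for j
    using I T k subgroup.m_inv_closed[OF B(2)]
    by (auto simp: closed_two_sided_ideal_def image_subset_iff)
  moreover have "complex_subspace I" using I by (simp add: closed_two_sided_ideal_def)
  ultimately have "(\<Sum>j<N. left_regular G (inv (k j)) o\<^sub>L T o\<^sub>L left_regular G (k j)) \<in> I"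
    by (intro complex_subspace_sum)
  then show ?thesis using \<open>complex_subspace I\<close>
    by (simp add: conj_average_def scaleR_conv_op_scaleC complex_subspace_def)
qed

text \<open>Approximate \<open>T\<close> by a finite combination \<open>Y\<close>. Averaging fixes
  the identity term of \<open>Y\<close>, whose coefficient is the trace of \<open>Y\<close>, and
  makes the other terms small. Both averaging and the trace are contractions, so passing from
  \<open>T\<close> to \<open>Y\<close> costs \<open>e / 3\<close> twice.\<close>

lemma conj_average_tendsto_trace:
  assumes T: "T \<in> reduced_cstar G (carrier G)" and e: "e > 0" and H: "H \<subseteq> carrier G"
    and displace: "\<And>F. finite F \<Longrightarrow> F \<subseteq> carrier G - {\<one>} \<Longrightarrow>
      \<exists>K U k. (\<forall>g\<in>F. \<forall>x\<in>U. g \<otimes> x \<notin> U) \<and> range k \<subseteq> H \<and>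
        (\<forall>x\<in>carrier G. finite {j :: nat. k j \<otimes> x \<notin> U} \<and> card {j. k j \<otimes> x \<notin> U} \<le> K)"
  obtains k N where "range k \<subseteq> H"
    "dist (conj_average k N T) (op_scaleC (ell2_fun (T (ell2_delta \<one>)) \<one>) (left_regular G \<one>)) < e"
proof -
  let ?tr = "\<lambda>T. ell2_fun (T (ell2_delta \<one>)) \<one>"
  have "\<exists>Y \<in> {\<Sum>h\<in>F. op_scaleC (a h) (left_regular G h) | F a. finite F \<and> F \<subseteq> carrier G}. dist Y T < e / 3"
    using T unfolding reduced_cstar_def closure_approachable
    by (elim allE[where x = "e / 3"]) (use e in simp)
  then obtain F a where F: "finite F" "F \<subseteq> carrier G"
    and "dist (\<Sum>h\<in>F. op_scaleC (a h) (left_regular G h)) T < e / 3" by blast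
  moreover define Y where "Y = (\<Sum>h\<in>F. op_scaleC (a h) (left_regular G h))"
  ultimately have Y: "norm (T - Y) < e / 3" by (simp add: dist_norm norm_minus_commute)
  have "finite (F - {\<one>})" "F - {\<one>} \<subseteq> carrier G - {\<one>}" using F by auto
  from displace[OF this] obtain K U k where KUk: "\<forall>g\<in>F - {\<one>}. \<forall>x\<in>U. g \<otimes> x \<notin> U"
    and kH: "range k \<subseteq> H"
    and K: "\<forall>x\<in>carrier G. finite {j :: nat. k j \<otimes> x \<notin> U} \<and> card {j. k j \<otimes> x \<notin> U} \<le> K"
    by (elim exE conjE)
  have U: "g \<otimes> x \<notin> U" if "g \<in> F - {\<one>}" "x \<in> U" for g x using KUk that by blast
  have k: "k j \<in> carrier G" for j using kH H by auto
  \<comment> \<open>\<open>C / sqrt (real N)\<close> bounds what the nontrivial elements of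
    \<open>F\<close> contribute to the average of \<open>Y\<close>; the choice of \<open>N\<close>
    below pushes it under \<open>e / 3\<close>.\<close>
  define C where "C = (\<Sum>g\<in>F - {\<one>}. cmod (a g) * (2 * sqrt (real K)))"
  have "C \<ge> 0" unfolding C_def by (intro sum_nonneg) auto
  obtain N :: nat where N: "N > (3 * (C + 1) / e)\<^sup>2"
    using reals_Archimedean2 by blast
  then have N0: "N > 0" using zero_le_power2[of "3 * (C + 1) / e"] by (metis of_nat_0_less_iff order_le_less_trans)
  have sqrtN: "3 * (C + 1) / e < sqrt (real N)"
    using N by (simp add: real_less_rsqrt)
  have avg_g: "norm (conj_average k N (left_regular G g)) \<le> 2 * sqrt (real K) / sqrt (real N)"
    if g: "g \<in> F - {\<one>}" for g
  proof -
    have gG: "g \<in> carrier G" using g F by auto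
    have "norm (\<Sum>j<N. left_regular G (inv (k j) \<otimes> g \<otimes> k j)) \<le> 2 * sqrt (real K * real N)"
    proof (rule norm_sum_conj_le[OF gG U[OF g] k])
      fix x assume "x \<in> carrier G"
      \<comment> \<open>An infinite set has \<open>card\<close> equal to 0, so the bound
        \<open>K\<close> passes to the first \<open>N\<close> indices only because
        \<open>displace\<close> also supplies finiteness.\<close>
      have "card {j. j < N \<and> k j \<otimes> x \<notin> U} \<le> card {j. k j \<otimes> x \<notin> U}"
        using bspec[OF K \<open>x \<in> carrier G\<close>] by (intro card_mono) auto
      then show "card {j. j < N \<and> k j \<otimes> x \<notin> U} \<le> K"
        using bspec[OF K \<open>x \<in> carrier G\<close>] by linarith
    qed
    then have "norm (conj_average k N (left_regular G g)) \<le> inverse (real N) * (2 * sqrt (real K * real N))"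
      by (simp add: conj_average_left_regular[OF k gG] mult_left_mono)
    also have "\<dots> = 2 * sqrt (real K) / sqrt (real N)"
      using N0 by (simp add: real_sqrt_mult field_simps)
    finally show ?thesis .
  qed
  have avg_one: "conj_average k N (left_regular G \<one>) = left_regular G \<one>"
    using N0 by (simp add: conj_average_left_regular[OF k] k sum_constant_scaleR)
  have trY: "?tr Y = (if \<one> \<in> F then a \<one> else 0)"
  proof -
    have "?tr Y = (\<Sum>h\<in>F. if h = \<one> then a h else 0)"
      unfolding Y_def using F(2)
      by (auto simp: blinfun.sum_left ell2_fun_sum ell2_fun_op_scaleC left_regular_delta
          ell2_delta.rep_eq subset_iff intro!: sum.cong)
    then show ?thesis using F(1) by simp
  qed
  have "conj_average k N Y = (\<Sum>g\<in>F. op_scaleC (a g) (conj_average k N (left_regular G g)))"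
    unfolding Y_def by (rule conj_average_sum[OF k])
  also have "\<dots> = op_scaleC (?tr Y) (left_regular G \<one>)
      + (\<Sum>g\<in>F - {\<one>}. op_scaleC (a g) (conj_average k N (left_regular G g)))"
  proof (cases "\<one> \<in> F")
    case True
    then show ?thesis by (simp add: trY sum.remove[OF F(1)] avg_one)
  next
    \<comment> \<open>Here the trace of \<open>Y\<close> is 0, and the term split off
      vanishes.\<close>
    case False
    have "op_scaleC 0 (left_regular G \<one>) = 0"
      by (intro blinfun_ell2_eqI) (simp add: ell2_fun_op_scaleC zero_ell2.rep_eq)
    then show ?thesis using False by (simp add: trY)
  qed
  finally have avgY: "conj_average k N Y - op_scaleC (?tr Y) (left_regular G \<one>)
      = (\<Sum>g\<in>F - {\<one>}. op_scaleC (a g) (conj_average k N (left_regular G g)))" by simp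
  have "norm (conj_average k N Y - op_scaleC (?tr Y) (left_regular G \<one>))
      \<le> (\<Sum>g\<in>F - {\<one>}. cmod (a g) * (2 * sqrt (real K) / sqrt (real N)))"
    unfolding avgY
    by (intro sum_norm_le order_trans[OF norm_op_scaleC_le] mult_left_mono avg_g) auto
  also have "\<dots> = C / sqrt (real N)"
    by (simp add: C_def sum_divide_distrib)
  also have "\<dots> < e / 3"
    using sqrtN N0 e \<open>C \<ge> 0\<close> by (simp add: field_simps)
  finally have 2: "norm (conj_average k N Y - op_scaleC (?tr Y) (left_regular G \<one>)) < e / 3" .
  have 1: "norm (conj_average k N T - conj_average k N Y) < e / 3"
    using norm_conj_average_le[of k N "T - Y", OF k N0] Y by (simp add: conj_average_diff[OF k])
  \<comment> \<open>The trace is a contraction: it reads one coordinate of the image of a unit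
    vector.\<close>
  have "cmod (?tr Y - ?tr T) = cmod (ell2_fun ((Y - T) (ell2_delta \<one>)) \<one>)"
    by (simp add: blinfun.diff_left linear_diff[OF bounded_linear.linear[OF bounded_linear_ell2_fun]])
  also have "\<dots> \<le> norm (Y - T) * norm (ell2_delta \<one> :: 'a ell2)"
    by (rule order_trans[OF cmod_ell2_fun_le_norm norm_blinfun])
  also have "\<dots> < e / 3" using Y by (simp add: norm_ell2_delta norm_minus_commute)
  finally have tr: "cmod (?tr Y - ?tr T) < e / 3" .
  have 3: "norm (op_scaleC (?tr Y) (left_regular G \<one>) - op_scaleC (?tr T) (left_regular G \<one>)) < e / 3"
    using norm_op_scaleC_le[of "?tr Y - ?tr T" "left_regular G \<one>"]
      mult_left_mono[OF norm_left_regular_le[OF one_closed] norm_ge_zero[of "?tr Y - ?tr T"]] tr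
    unfolding op_scaleC_diff[symmetric] by linarith
  have "dist (conj_average k N T) (op_scaleC (?tr T) (left_regular G \<one>)) < e"
    unfolding dist_norm
    using norm_triangle_ineq[of "conj_average k N T - conj_average k N Y"
        "conj_average k N Y - op_scaleC (?tr Y) (left_regular G \<one>)"]
      norm_triangle_ineq[of "conj_average k N T - op_scaleC (?tr Y) (left_regular G \<one>)"
        "op_scaleC (?tr Y) (left_regular G \<one>) - op_scaleC (?tr T) (left_regular G \<one>)"] 1 2 3
    by simp
  then show ?thesis using that kH by blast
qed

section \<open>Faithfulness of the trace and simplicity\<close>

text \<open>For \<open>T \<noteq> 0\<close> in \<open>I\<close> with adjoint \<open>S\<close>, the
  trace of \<open>T o\<^sub>L S\<close> is the squared norm of \<open>S (ell2_delta \<one>)\<close>.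
  If that vector vanished, right invariance would make \<open>S\<close> vanish on all point masses,
  whereas a nonzero coordinate of some \<open>T f\<close> pairs \<open>f\<close> nontrivially with
  some \<open>S (ell2_delta y)\<close>.\<close>

lemma ideal_trace_nonzero:
  assumes I: "closed_two_sided_ideal I B" and B: "cstar_algebra B" "B \<subseteq> reduced_cstar G (carrier G)"
    and nz: "I \<noteq> {0}"
  obtains X where "X \<in> I" "ell2_fun (X (ell2_delta \<one>)) \<one> \<noteq> 0"
proof -
  have "0 \<in> I" using I by (simp add: closed_two_sided_ideal_def complex_subspace_def)
  then obtain T where T: "T \<in> I" "T \<noteq> 0" using nz by blast
  then have TB: "T \<in> B" using I by (auto simp: closed_two_sided_ideal_def)
  then obtain S where S: "S \<in> B" "is_adjoint T S" using B by (auto simp: cstar_algebra_def)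
  obtain f y where "ell2_fun (T f) y \<noteq> 0"
    using T(2) blinfun_ell2_eqI[of T 0] by (auto simp: zero_ell2.rep_eq)
  then have y: "y \<in> carrier G" "ell2_cinner f (S (ell2_delta y)) \<noteq> 0"
    using reduced_cstar_off_carrier[of T y f] TB B(2) S(2)
    by (auto simp: is_adjoint_def ell2_cinner_delta[symmetric])
  have "S (ell2_delta \<one>) \<noteq> 0"
  proof
    assume 0: "S (ell2_delta \<one>) = 0"
    have SG: "S \<in> reduced_cstar G (carrier G)" using S(1) B(2) by blast
    have "ell2_fun (S (ell2_delta y)) x = 0" for x
      using reduced_cstar_right_invariant[OF SG _ y(1), of x] reduced_cstar_off_carrier[OF SG, of x]
      by (cases "x \<in> carrier G") (auto simp: 0 zero_ell2.rep_eq)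
    then show False using y(2) by (simp add: ell2_cinner_def)
  qed
  moreover have "ell2_fun ((T o\<^sub>L S) (ell2_delta \<one>)) \<one>
      = ell2_cinner (S (ell2_delta \<one>)) (S (ell2_delta \<one>))"
    using S(2) by (simp add: is_adjoint_def ell2_cinner_delta[symmetric])
  moreover have "ell2_cinner g g \<noteq> 0" if "g \<noteq> 0" for g :: "'a ell2"
    using that by (metis inner_ell2_def inner_eq_zero_iff zero_complex.sel(1))
  moreover have "T o\<^sub>L S \<in> I" using I T(1) S(1) by (auto simp: closed_two_sided_ideal_def)
  ultimately show ?thesis using that by simp
qed

text \<open>A nonzero ideal \<open>I\<close> contains some \<open>X\<close> of nonzero trace
  \<open>c\<close>. Averages of \<open>X\<close> stay in \<open>I\<close> and come arbitrarily close
  to \<open>c\<close> times the unit; as \<open>I\<close> is closed, it contains the unit and is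
  everything. \<open>K\<close>, \<open>U\<close> and \<open>k\<close> may all depend on
  \<open>F\<close>, because each approximation of \<open>X\<close> involves only finitely many group
  elements.\<close>

lemma cstar_irreducibleI:
  assumes H: "subgroup H G"
    and displace: "\<And>F. finite F \<Longrightarrow> F \<subseteq> carrier G - {\<one>} \<Longrightarrow>
      \<exists>K U k. (\<forall>g\<in>F. \<forall>x\<in>U. g \<otimes> x \<notin> U) \<and> range k \<subseteq> H \<and>
        (\<forall>x\<in>carrier G. finite {j :: nat. k j \<otimes> x \<notin> U} \<and> card {j. k j \<otimes> x \<notin> U} \<le> K)"
  shows "cstar_irreducible G H"
proof -
  have "simple_cstar_algebra B" if B: "cstar_algebra B" "reduced_cstar G H \<subseteq> B"
    "B \<subseteq> reduced_cstar G (carrier G)" for B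
    unfolding simple_cstar_algebra_def
  proof (intro conjI allI impI)
    have one: "left_regular G \<one> \<in> B"
      using left_regular_in_reduced_cstar[OF subgroup.one_closed[OF H], of G] B(2) by (rule rev_subsetD)
    have "ell2_fun (left_regular G \<one> (ell2_delta \<one>)) \<one> \<noteq> 0"
      by (simp add: left_regular_delta ell2_delta.rep_eq)
    then have "left_regular G \<one> \<noteq> 0" by (auto simp: zero_ell2.rep_eq)
    then show "B \<noteq> {0}" using one by blast
    fix I assume I: "closed_two_sided_ideal I B"
    show "I = {0} \<or> I = B"
    proof (rule disjCI)
      assume "I \<noteq> B"
      show "I = {0}"
      proof (rule ccontr)
        assume "I \<noteq> {0}"
        then obtain X where X: "X \<in> I" and tr: "ell2_fun (X (ell2_delta \<one>)) \<one> \<noteq> 0"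
          using ideal_trace_nonzero[OF I B(1,3)] by blast
        define c where "c = ell2_fun (X (ell2_delta \<one>)) \<one>"
        have XG: "X \<in> reduced_cstar G (carrier G)"
          using X I B(3) by (auto simp: closed_two_sided_ideal_def)
        have "op_scaleC c (left_regular G \<one>) \<in> closure I"
          unfolding closure_approachable
        proof (intro allI impI)
          fix e :: real assume "e > 0"
          obtain k N where "range k \<subseteq> H" "dist (conj_average k N X) (op_scaleC c (left_regular G \<one>)) < e"
            unfolding c_def
            by (rule conj_average_tendsto_trace[OF XG \<open>e > 0\<close> subgroup.subset[OF H]])
              (use displace in auto)
          then show "\<exists>Y\<in>I. dist Y (op_scaleC c (left_regular G \<one>)) < e"
            using conj_average_in_ideal[OF I B(2) H _ X] by blast
        qed
        moreover have "closure I = I" using I by (simp add: closed_two_sided_ideal_def)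
        ultimately have "op_scaleC (inverse c) (op_scaleC c (left_regular G \<one>)) \<in> I"
          using I by (auto simp: closed_two_sided_ideal_def complex_subspace_def)
        then have one_I: "left_regular G \<one> \<in> I"
          using tr by (simp add: op_scaleC_op_scaleC c_def op_scaleC_one)
        have "T \<in> I" if "T \<in> B" for T
        proof -
          have "T o\<^sub>L left_regular G \<one> \<in> I"
            using I one_I that by (auto simp: closed_two_sided_ideal_def)
          then show ?thesis using reduced_cstar_comp_one[of T] that B(3) by auto
        qed
        then show False using I \<open>I \<noteq> B\<close> by (auto simp: closed_two_sided_ideal_def)
      qed
    qed
  qed (rule B(1))
  then show ?thesis using H is_group by (auto simp: cstar_irreducible_def)
qed

end

unbundle no vec_syntax

section \<open>Translation of polynomials\<close>

text \<open>For nonzero \<open>P\<close> with roots \<open>z\<^sub>i\<close>, listed with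
  multiplicity, coefficient \<open>k\<close> of the translate is \<open>poly P c\<close> times the
  \<open>k\<close>-th elementary symmetric function of the reciprocals of
  \<open>c - z\<^sub>i\<close>. It has at most \<open>2 ^ degree P\<close> terms, each of modulus at
  most \<open>1 / R ^ k\<close>. The induction splits off one root at a time and doubles the
  constant.\<close>

lemma coeff_translate_le:
  fixes P :: "complex poly"
  assumes R: "R > 0" and roots: "\<And>z. poly P z = 0 \<Longrightarrow> R \<le> cmod (c - z)"
  shows "cmod (coeff (P \<circ>\<^sub>p [:c, 1:]) k) \<le> 2 ^ degree P / R ^ k * cmod (poly P c)"
  using roots
proof (induction "degree P" arbitrary: P k)
  case 0
  then obtain a where "P = [:a:]" by (metis degree_eq_zeroE)
  then show ?case using R by (cases k) (auto simp: pcompose_const)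
next
  case (Suc d)
  obtain z where z: "poly P z = 0"
    using fundamental_theorem_of_algebra[of P] Suc.hyps(2) by (auto simp: constant_degree)
  then obtain Q where P: "P = [:-z, 1:] * Q"
    by (auto simp: poly_eq_0_iff_dvd)
  have "Q \<noteq> 0" using Suc.hyps(2) P by auto
  then have deg: "degree Q = d"
    using Suc.hyps(2) unfolding P by (subst (asm) degree_mult_eq) auto
  define q where "q = Q \<circ>\<^sub>p [:c, 1:]"
  have q: "cmod (coeff q k) \<le> 2 ^ d / R ^ k * cmod (poly Q c)" for k
    using Suc.hyps(1)[of Q k] Suc.prems deg by (simp add: P q_def)
  have az: "R \<le> cmod (c - z)" using Suc.prems z by blast
  have Pc: "P \<circ>\<^sub>p [:c, 1:] = [:c - z, 1:] * q"
    unfolding P q_def pcompose_mult by (simp add: pcompose_pCons)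
  have bound: "cmod ((c - z) * coeff q k) \<le> cmod (c - z) * (2 ^ d / R ^ k * cmod (poly Q c))"
    unfolding norm_mult by (intro mult_left_mono q) auto
  have "cmod (coeff (P \<circ>\<^sub>p [:c, 1:]) k) \<le> 2 * (cmod (c - z) * (2 ^ d / R ^ k * cmod (poly Q c)))"
  proof (cases k)
    case 0
    have "0 \<le> cmod (c - z) * (2 ^ d / R ^ k * cmod (poly Q c))" using R by simp
    then have "cmod ((c - z) * coeff q k) \<le> 2 * (cmod (c - z) * (2 ^ d / R ^ k * cmod (poly Q c)))"
      using bound by linarith
    then show ?thesis by (simp add: Pc 0)
  next
    case (Suc k')
    \<comment> \<open>The shifted coefficient carries one power of \<open>R\<close> less in its
      denominator; the missing factor is absorbed by \<open>R \<le> cmod (c - z)\<close>.\<close>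
    have "cmod (coeff q k') \<le> R * (2 ^ d / R ^ k * cmod (poly Q c))"
      using q[of k'] R by (simp add: Suc)
    also have "\<dots> \<le> cmod (c - z) * (2 ^ d / R ^ k * cmod (poly Q c))"
      using az R by (intro mult_right_mono) auto
    finally have "cmod ((c - z) * coeff q k) + cmod (coeff q k')
        \<le> 2 * (cmod (c - z) * (2 ^ d / R ^ k * cmod (poly Q c)))" using bound by simp
    moreover have "coeff (P \<circ>\<^sub>p [:c, 1:]) k = (c - z) * coeff q k + coeff q k'"
      by (simp add: Pc Suc)
    ultimately show ?thesis using norm_triangle_ineq order_trans by metis
  qed
  also have "\<dots> = 2 ^ degree P / R ^ k * cmod (poly P c)"
  proof -
    have "poly P c = (c - z) * poly Q c" by (simp add: P algebra_simps)
    then show ?thesis by (simp add: norm_mult Suc.hyps(2)[symmetric])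
  qed
  finally show ?case .
qed

text \<open>A translation parameter is exceptional only if it is close to a root, and the chosen
  parameters are so sparse that each root spoils at most one of them.\<close>

lemma translate_exceptions:
  fixes n :: nat and d :: real
  assumes "d > 0"
  obtains m :: nat where "\<And>P :: complex poly. P \<noteq> 0 \<Longrightarrow> degree P < n \<Longrightarrow>
    finite {j :: nat. \<exists>k>0. cmod (coeff (P \<circ>\<^sub>p [:of_nat (m * j), 1:]) k) > d * cmod (poly P (of_nat (m * j)))} \<and>
    card {j :: nat. \<exists>k>0. cmod (coeff (P \<circ>\<^sub>p [:of_nat (m * j), 1:]) k) > d * cmod (poly P (of_nat (m * j)))} \<le> n"
proof -
  \<comment> \<open>\<open>R\<close> makes \<open>2 ^ n / R ^ k\<close> at most \<open>d\<close> for
    every \<open>k > 0\<close>, where \<open>R \<ge> 1\<close> reduces to \<open>k = 1\<close>. With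
    \<open>m \<ge> 2 * R\<close>, two distinct multiples of \<open>m\<close> cannot both be closer
    than \<open>R\<close> to the same root.\<close>
  define R where "R = max 1 (2 ^ n / d)"
  define m where "m = nat \<lceil>2 * R\<rceil>"
  have R: "R \<ge> 1" "2 ^ n / d \<le> R" by (auto simp: R_def)
  have m: "real m \<ge> 2 * R" unfolding m_def by linarith
  show ?thesis
  proof (rule that[of m])
    fix P :: "complex poly" assume P: "P \<noteq> 0" "degree P < n"
    define J where "J = {j :: nat. \<exists>k>0. cmod (coeff (P \<circ>\<^sub>p [:of_nat (m * j), 1:]) k)
      > d * cmod (poly P (of_nat (m * j)))}"
    have "\<exists>z. poly P z = 0 \<and> cmod (of_nat (m * j) - z) < R" if "j \<in> J" for j
    proof (rule ccontr)
      assume "\<not> ?thesis"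
      then have far: "\<And>z. poly P z = 0 \<Longrightarrow> R \<le> cmod (of_nat (m * j) - z)"
        by (auto simp: not_less)
      from that obtain k where k: "k > 0" "cmod (coeff (P \<circ>\<^sub>p [:of_nat (m * j), 1:]) k)
          > d * cmod (poly P (of_nat (m * j)))" unfolding J_def by (elim CollectE exE conjE)
      have "(2 :: real) ^ degree P \<le> 2 ^ n" using P(2) by simp
      also have "2 ^ n \<le> d * R" using R(2) assms by (simp add: field_simps)
      also have "\<dots> \<le> d * R ^ k"
        using R(1) k(1) assms by (intro mult_left_mono self_le_power) auto
      finally have "2 ^ degree P / R ^ k \<le> d" using R(1) by (simp add: divide_simps)
      then have "2 ^ degree P / R ^ k * cmod (poly P (of_nat (m * j))) \<le> d * cmod (poly P (of_nat (m * j)))"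
        by (intro mult_right_mono) auto
      then show False using coeff_translate_le[of R P "of_nat (m * j)" k, OF _ far] R(1) k(2) by linarith
    qed
    then obtain z where z: "\<And>j. j \<in> J \<Longrightarrow> poly P (z j) = 0 \<and> cmod (of_nat (m * j) - z j) < R"
      by metis
    have inj: "inj_on z J"
    proof (rule inj_onI)
      fix i j assume ij: "i \<in> J" "j \<in> J" "z i = z j"
      have "cmod (of_nat (m * i) - of_nat (m * j)) < 2 * R"
        using z[OF ij(1)] z[OF ij(2)] ij(3)
          norm_triangle_ineq4[of "of_nat (m * i) - z i" "of_nat (m * j) - z j"] by simp
      moreover have "of_nat (m * i) - of_nat (m * j) = complex_of_real (real m * (real i - real j))"
        by (simp add: algebra_simps)
      ultimately have "real m * \<bar>real i - real j\<bar> < 2 * R"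
        by (simp only: norm_of_real abs_mult abs_of_nat)
      also have "\<dots> \<le> real m * 1" using m by simp
      finally have "\<bar>real i - real j\<bar> < 1" using m R(1) by (simp add: mult_less_cancel_left)
      then show "i = j" by linarith
    qed
    have sub: "z ` J \<subseteq> {w. poly P w = 0}" using z by blast
    have fin: "finite {w. poly P w = 0}" using P(1) by (rule poly_roots_finite)
    have "finite (z ` J)" using sub fin by (rule finite_subset)
    then have "finite J" using inj by (rule finite_imageD)
    moreover have "card J = card (z ` J)" using inj by (simp add: card_image)
    moreover have "card (z ` J) \<le> card {w. poly P w = 0}" using fin sub by (rule card_mono)
    moreover have "card {w. poly P w = 0} \<le> degree P" using P(1) by (rule card_poly_roots_bound)
    ultimately have "finite J \<and> card J \<le> n" using P(2) by linarith
    then show "finite {j :: nat. \<exists>k>0. cmod (coeff (P \<circ>\<^sub>p [:of_nat (m * j), 1:]) k)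
          > d * cmod (poly P (of_nat (m * j)))} \<and>
        card {j :: nat. \<exists>k>0. cmod (coeff (P \<circ>\<^sub>p [:of_nat (m * j), 1:]) k)
          > d * cmod (poly P (of_nat (m * j)))} \<le> n"
      unfolding J_def .
  qed
qed

text \<open>For \<open>k > l\<close> both sides vanish, so the truncated subtraction in the exponent
  does no harm and no bound on \<open>k\<close> has to be carried along.\<close>

lemma coeff_linear_power_choose:
  fixes c :: "'a :: comm_ring_1"
  shows "coeff ([:c, 1:] ^ l) k = of_nat (l choose k) * c ^ (l - k)"
proof (cases "k \<le> l")
  case True
  then show ?thesis by (simp add: coeff_linear_poly_power)
next
  case False
  then have "degree ([:c, 1:] ^ l) < k" using degree_power_le[of "[:c, 1:]" l] by simp
  then show ?thesis using False by (simp add: coeff_eq_0 binomial_eq_0)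
qed

lemma pcompose_monom: "monom a l \<circ>\<^sub>p q = smult a (q ^ l)" for a :: "'a :: comm_ring_1"
  by (induction l) (simp_all add: monom_0 monom_Suc pcompose_pCons mult.commute)

lemma coeff_translate_eq_sum:
  fixes a :: "nat \<Rightarrow> 'a :: comm_ring_1"
  shows "coeff ((\<Sum>l<n. monom (a l) l) \<circ>\<^sub>p [:c, 1:]) k = (\<Sum>l<n. of_nat (l choose k) * c ^ (l - k) * a l)"
  by (simp add: pcompose_sum pcompose_monom coeff_sum coeff_linear_power_choose mult_ac)

section \<open>Displacement of a neighbourhood of a rational line\<close>

text \<open>A neighbourhood of the line through \<open>(1, t, \<dots>, t\<^sup>n\<^sup>-\<^sup>1)\<close>.\<close>

definition line_nbhd :: "nat \<Rightarrow> rat \<Rightarrow> rat \<Rightarrow> rat vec set" where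
  "line_nbhd n t d = {x \<in> carrier_vec n. x $ 0 \<noteq> 0 \<and> (\<forall>i<n. \<bar>x $ i - t ^ i * x $ 0\<bar> \<le> d * \<bar>x $ 0\<bar>)}"

lemma line_nbhd_mono: "d \<le> d' \<Longrightarrow> line_nbhd n t d \<subseteq> line_nbhd n t d'"
  unfolding line_nbhd_def by (auto intro: order_trans mult_right_mono)

text \<open>All the defining conditions are homogeneous, so the neighbourhood is a set of lines. A
  class in the projective group determines the image of a vector only up to a nonzero
  scalar.\<close>

lemma line_nbhd_smult:
  assumes "x \<in> line_nbhd n t d" "c \<noteq> 0" "n > 0"
  shows "c \<cdot>\<^sub>v x \<in> line_nbhd n t d"
proof -
  have x: "x \<in> carrier_vec n" using assms by (simp add: line_nbhd_def)
  have "\<bar>c * x $ i - t ^ i * (c * x $ 0)\<bar> \<le> d * \<bar>c * x $ 0\<bar>" if "i < n" for i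
  proof -
    have "\<bar>c * x $ i - t ^ i * (c * x $ 0)\<bar> = \<bar>c\<bar> * \<bar>x $ i - t ^ i * x $ 0\<bar>"
      by (simp add: abs_mult[symmetric] algebra_simps)
    also have "\<dots> \<le> \<bar>c\<bar> * (d * \<bar>x $ 0\<bar>)"
      using assms(1) that by (intro mult_left_mono) (auto simp: line_nbhd_def)
    finally show ?thesis by (simp add: abs_mult algebra_simps)
  qed
  then show ?thesis using assms x by (auto simp: line_nbhd_def)
qed

text \<open>If the set is infinite, the rows of \<open>M\<close>, read as polynomials in \<open>t\<close> of degree less than
  \<open>n\<close>, are \<open>p, t p, t\<^sup>2 p, \<dots>\<close>, so \<open>p\<close> is constant.\<close>

lemma finite_fixed_lines:
  fixes M :: "rat mat"
  assumes M: "M \<in> carrier_mat n n" and ns: "\<And>c. M \<noteq> c \<cdot>\<^sub>m 1\<^sub>m n"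
  shows "finite {t. \<forall>i<n. (\<Sum>l<n. M $$ (i, l) * t ^ l) = t ^ i * (\<Sum>l<n. M $$ (0, l) * t ^ l)}"
proof (rule ccontr)
  assume inf: "infinite {t. \<forall>i<n. (\<Sum>l<n. M $$ (i, l) * t ^ l) = t ^ i * (\<Sum>l<n. M $$ (0, l) * t ^ l)}"
    (is "infinite ?A")
  define r where "r i = (\<Sum>l<n. monom (M $$ (i, l)) l)" for i
  have coeff_r: "coeff (r i) l = (if l < n then M $$ (i, l) else 0)" for i l
    by (simp add: r_def coeff_sum)
  have poly_r: "poly (r i) t = (\<Sum>l<n. M $$ (i, l) * t ^ l)" for i t
    by (simp add: r_def poly_sum poly_monom)
  have r: "r i = monom 1 i * r 0" if "i < n" for i
  proof (rule ccontr)
    assume "r i \<noteq> monom 1 i * r 0"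
    then have "finite {t. poly (r i - monom 1 i * r 0) t = 0}" by (intro poly_roots_finite) simp
    moreover have "?A \<subseteq> {t. poly (r i - monom 1 i * r 0) t = 0}"
      using that by (auto simp: poly_r poly_monom)
    ultimately show False using inf finite_subset by blast
  qed
  have coeff_r0: "coeff (r 0) l = 0" if "l > 0" for l
  proof (cases n)
    case (Suc m)
    \<comment> \<open>Here \<open>m = n - 1\<close>: the last row has degree at most
      \<open>m\<close>, but it is \<open>r 0\<close> shifted up by \<open>m\<close> degrees, so
      \<open>r 0\<close> has no coefficient of positive degree.\<close>
    then have "coeff (r m) (l + m) = coeff (r 0) l" by (subst r) (auto simp: coeff_monom_mult)
    then show ?thesis using that Suc by (simp add: coeff_r[of m])
  qed (simp add: r_def)
  have "M = M $$ (0, 0) \<cdot>\<^sub>m 1\<^sub>m n"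
  proof (rule eq_matI)
    fix i l assume "i < dim_row (M $$ (0, 0) \<cdot>\<^sub>m 1\<^sub>m n)" "l < dim_col (M $$ (0, 0) \<cdot>\<^sub>m 1\<^sub>m n)"
    then have il: "i < n" "l < n" by auto
    have "M $$ (i, l) = coeff (monom 1 i * r 0) l" using il r[OF il(1)] coeff_r[of i l] by simp
    also have "\<dots> = (if i = l then M $$ (0, 0) else 0)"
      using coeff_r0[of "l - i"] coeff_r[of 0 0] il by (auto simp: coeff_monom_mult)
    finally show "M $$ (i, l) = (M $$ (0, 0) \<cdot>\<^sub>m 1\<^sub>m n) $$ (i, l)" using il by simp
  qed (use M in auto)
  with ns show False by blast
qed

lemma index_mult_mat_vec_sum:
  assumes "M \<in> carrier_mat m n" "x \<in> carrier_vec n" "i < m"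
  shows "(M *\<^sub>v x) $ i = (\<Sum>l<n. M $$ (i, l) * x $ l)"
  using assms by (auto simp: scalar_prod_def atLeast0LessThan)

text \<open>The hypothesis \<open>ne\<close> says that \<open>M\<close> moves the vector of powers
  of \<open>t\<close> off its line, with defect \<open>D\<close> in coordinate \<open>i\<close>. On
  the neighbourhood this persists up to an error of order \<open>d\<close>, so a small
  \<open>d\<close> excludes a return.\<close>

lemma line_nbhd_displaced:
  fixes M :: "rat mat"
  assumes M: "M \<in> carrier_mat n n" and n: "n > 0" and i: "i < n"
    and ne: "(\<Sum>l<n. M $$ (i, l) * t ^ l) \<noteq> t ^ i * (\<Sum>l<n. M $$ (0, l) * t ^ l)"
  obtains d where "d > 0" "\<And>x. x \<in> line_nbhd n t d \<Longrightarrow> M *\<^sub>v x \<notin> line_nbhd n t d"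
proof -
  define q where "q k = (\<Sum>l<n. M $$ (k, l) * t ^ l)" for k
  define S where "S k = (\<Sum>l<n. \<bar>M $$ (k, l)\<bar>)" for k
  define D where "D = \<bar>q i - t ^ i * q 0\<bar>"
  \<comment> \<open>\<open>E - 1\<close> collects the coefficients of
    \<open>d * \<bar>x $ 0\<bar>\<close> in the estimate at the end; the added 1 makes
    \<open>E\<close> positive. Taking \<open>d \<le> 1\<close> bounds the terms quadratic in
    \<open>d\<close> by linear ones.\<close>
  define E where "E = S i + \<bar>t ^ i\<bar> * S 0 + \<bar>q 0\<bar> + S 0 + 1"
  have S0: "S k \<ge> 0" for k unfolding S_def by (intro sum_nonneg) auto
  have D: "D > 0" using ne by (simp add: D_def q_def)
  have E: "E > 0" unfolding E_def using S0[of i] S0[of 0]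
    by (intro add_nonneg_pos add_nonneg_nonneg) auto
  define d where "d = min 1 (D / (2 * E))"
  have d: "d > 0" "d \<le> 1" "d * E < D"
  proof -
    have "d * E \<le> D / (2 * E) * E" using E by (intro mult_right_mono) (auto simp: d_def)
    then show "d * E < D" using D E by simp
  qed (use D E in \<open>auto simp: d_def\<close>)
  show ?thesis
  proof (rule that[OF d(1)])
    fix x assume x: "x \<in> line_nbhd n t d"
    have xn: "x \<in> carrier_vec n" using x by (simp add: line_nbhd_def)
    let ?a = "\<bar>x $ 0\<bar>"
    have a: "?a > 0" using x by (simp add: line_nbhd_def)
    have close: "\<bar>(M *\<^sub>v x) $ k - q k * x $ 0\<bar> \<le> S k * (d * ?a)" if "k < n" for k
    proof -
      have "(M *\<^sub>v x) $ k - q k * x $ 0 = (\<Sum>l<n. M $$ (k, l) * (x $ l - t ^ l * x $ 0))"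
        by (simp add: index_mult_mat_vec_sum[OF M xn that] q_def sum_distrib_right
            sum_subtractf[symmetric] right_diff_distrib mult.assoc)
      also have "\<bar>\<dots>\<bar> \<le> (\<Sum>l<n. \<bar>M $$ (k, l)\<bar> * (d * ?a))"
        using x by (intro order_trans[OF sum_abs] sum_mono)
          (auto simp: abs_mult line_nbhd_def intro!: mult_left_mono)
      finally show ?thesis by (simp add: S_def sum_distrib_right)
    qed
    show "M *\<^sub>v x \<notin> line_nbhd n t d"
    proof
      assume "M *\<^sub>v x \<in> line_nbhd n t d"
      then have le: "\<bar>(M *\<^sub>v x) $ i - t ^ i * (M *\<^sub>v x) $ 0\<bar> \<le> d * \<bar>(M *\<^sub>v x) $ 0\<bar>"
        using i by (simp add: line_nbhd_def)
      let ?u = "(M *\<^sub>v x) $ i - q i * x $ 0" and ?v = "(M *\<^sub>v x) $ 0 - q 0 * x $ 0"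
      have v: "\<bar>?v\<bar> \<le> S 0 * (d * ?a)" and u: "\<bar>?u\<bar> \<le> S i * (d * ?a)" using close i n by auto
      have "D * ?a = \<bar>((M *\<^sub>v x) $ i - t ^ i * (M *\<^sub>v x) $ 0) - ?u + t ^ i * ?v\<bar>"
        by (simp add: D_def abs_mult[symmetric] algebra_simps)
      also have "\<dots> \<le> \<bar>(M *\<^sub>v x) $ i - t ^ i * (M *\<^sub>v x) $ 0\<bar> + \<bar>?u\<bar> + \<bar>t ^ i * ?v\<bar>"
        by linarith
      also have "\<dots> \<le> d * \<bar>(M *\<^sub>v x) $ 0\<bar> + S i * (d * ?a) + \<bar>t ^ i\<bar> * (S 0 * (d * ?a))"
        unfolding abs_mult[of "t ^ i"] by (intro add_mono le u mult_left_mono v) auto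
      also have "\<dots> \<le> d * (\<bar>q 0\<bar> * ?a + S 0 * ?a) + S i * (d * ?a) + \<bar>t ^ i\<bar> * (S 0 * (d * ?a))"
      proof -
        have "S 0 * (d * ?a) \<le> S 0 * (1 * ?a)"
          using S0 d by (intro mult_left_mono mult_right_mono) auto
        then have "\<bar>(M *\<^sub>v x) $ 0\<bar> \<le> \<bar>q 0 * x $ 0\<bar> + S 0 * ?a" using v by linarith
        then show ?thesis using d(1) by (simp add: abs_mult mult_left_mono)
      qed
      also have "\<dots> = d * (E - 1) * ?a" by (simp add: E_def algebra_simps)
      also have "\<dots> \<le> d * E * ?a" using d(1) by (intro mult_right_mono mult_left_mono) auto
      also have "\<dots> < D * ?a" using d(3) a by simp
      finally show False by simp
    qed
  qed
qed

text \<open>Each matrix rules out finitely many parameters, so some natural number \<open>t\<close>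
  serves all of them. Taking \<open>t\<close> in the natural numbers keeps the vector of its powers
  integral, so that it can be a column of an integral matrix of determinant 1.\<close>

lemma line_nbhd_finitely_displaced:
  fixes \<M> :: "rat mat set"
  assumes fin: "finite \<M>" and n: "n > 0"
    and M: "\<And>M. M \<in> \<M> \<Longrightarrow> M \<in> carrier_mat n n" "\<And>M c. M \<in> \<M> \<Longrightarrow> M \<noteq> c \<cdot>\<^sub>m 1\<^sub>m n"
  obtains t :: nat and d where "d > 0"
    "\<And>M x. M \<in> \<M> \<Longrightarrow> x \<in> line_nbhd n (of_nat t) d \<Longrightarrow> M *\<^sub>v x \<notin> line_nbhd n (of_nat t) d"
proof -
  let ?A = "\<lambda>M. {t. \<forall>i<n. (\<Sum>l<n. M $$ (i, l) * t ^ l) = t ^ i * (\<Sum>l<n. M $$ (0, l) * t ^ l)}"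
  have "finite (\<Union>M\<in>\<M>. ?A M)" using fin finite_fixed_lines M by auto
  moreover have "infinite (range (of_nat :: nat \<Rightarrow> rat))"
    by (rule range_inj_infinite) (auto intro: injI)
  ultimately have "\<not> range (of_nat :: nat \<Rightarrow> rat) \<subseteq> (\<Union>M\<in>\<M>. ?A M)"
    using finite_subset by blast
  then obtain t :: nat where t: "of_nat t \<notin> (\<Union>M\<in>\<M>. ?A M)" by blast
  have "\<exists>d>0. \<forall>x\<in>line_nbhd n (of_nat t) d. M *\<^sub>v x \<notin> line_nbhd n (of_nat t) d" if "M \<in> \<M>" for M
  proof -
    have "of_nat t \<notin> ?A M" using t that by blast
    then obtain i where "i < n" "(\<Sum>l<n. M $$ (i, l) * of_nat t ^ l)
        \<noteq> of_nat t ^ i * (\<Sum>l<n. M $$ (0, l) * of_nat t ^ l)" by blast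
    from line_nbhd_displaced[OF M(1)[OF that] n this] show ?thesis by metis
  qed
  then obtain d where d: "\<And>M. M \<in> \<M> \<Longrightarrow> d M > 0"
      "\<And>M x. M \<in> \<M> \<Longrightarrow> x \<in> line_nbhd n (of_nat t) (d M) \<Longrightarrow> M *\<^sub>v x \<notin> line_nbhd n (of_nat t) (d M)"
    by metis
  \<comment> \<open>Neighbourhoods shrink with \<open>d\<close>, so the least one works for all
    matrices; the inserted 1 covers an empty set of matrices.\<close>
  define d' where "d' = Min (insert 1 (d ` \<M>))"
  have d'_le: "d' \<le> d M" if "M \<in> \<M>" for M using that fin by (simp add: d'_def)
  show ?thesis
  proof (rule that[of d' t])
    show "d' > 0" using fin d(1) by (simp add: d'_def)
    fix M x assume "M \<in> \<M>" "x \<in> line_nbhd n (of_nat t) d'"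
    then show "M *\<^sub>v x \<notin> line_nbhd n (of_nat t) d'"
      using d(2) line_nbhd_mono[OF d'_le] by blast
  qed
qed

section \<open>Integral unipotent matrices that bring vectors near the line\<close>

lemma prod_list_diag_eq_one:
  fixes A :: "'a :: comm_monoid_mult mat"
  assumes "A \<in> carrier_mat n n" "\<And>i. i < n \<Longrightarrow> A $$ (i, i) = 1"
  shows "prod_list (diag_mat A) = 1"
  unfolding prod_list_diag_prod by (rule prod.neutral) (use assms in auto)

lemma cmod_of_rat: "cmod (of_real (of_rat r)) = real_of_rat \<bar>r\<bar>"
  by simp

lemma smult_mat_mult_vec:
  assumes "A \<in> carrier_mat m n" "x \<in> carrier_vec n"
  shows "(c \<cdot>\<^sub>m A) *\<^sub>v x = c \<cdot>\<^sub>v (A *\<^sub>v x)"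
  using assms by (auto simp: scalar_prod_def sum_distrib_left mult.assoc intro!: eq_vecI)

text \<open>Read \<open>w\<close> as the coefficient vector of a nonzero polynomial. Except for at
  most \<open>n\<close> indices, its translate is dominated by the constant coefficient, that is,
  close to the first coordinate axis. One further integral matrix carries this axis to the line of
  \<open>t\<close>.\<close>

lemma returns_to_line_nbhd:
  fixes n t :: nat and d :: rat
  assumes n: "n > 0" and d: "d > 0"
  obtains k :: "nat \<Rightarrow> int mat" where "\<And>j. k j \<in> carrier_mat n n" "\<And>j. det (k j) = 1"
    "\<And>w. w \<in> carrier_vec n \<Longrightarrow> w \<noteq> 0\<^sub>v n \<Longrightarrow>
      finite {j. map_mat rat_of_int (k j) *\<^sub>v w \<notin> line_nbhd n (of_nat t) d} \<and>
      card {j. map_mat rat_of_int (k j) *\<^sub>v w \<notin> line_nbhd n (of_nat t) d} \<le> n"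
proof -
  have "real_of_rat d > 0" using d by simp
  then obtain m where m: "\<And>P :: complex poly. P \<noteq> 0 \<Longrightarrow> degree P < n \<Longrightarrow>
    finite {j :: nat. \<exists>k>0. cmod (coeff (P \<circ>\<^sub>p [:of_nat (m * j), 1:]) k)
      > real_of_rat d * cmod (poly P (of_nat (m * j)))} \<and>
    card {j :: nat. \<exists>k>0. cmod (coeff (P \<circ>\<^sub>p [:of_nat (m * j), 1:]) k)
      > real_of_rat d * cmod (poly P (of_nat (m * j)))} \<le> n"
    using translate_exceptions[of "real_of_rat d" n] by blast
  define A :: "int mat" where
    "A = mat n n (\<lambda>(i, l). if l = 0 then of_nat t ^ i else if i = l then 1 else 0)"
  \<comment> \<open>\<open>A\<close> sends the first basis vector to \<open>(1, t, \<dots>, t\<^sup>n\<^sup>-\<^sup>1)\<close>; \<open>Y c\<close> is the translation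
    \<open>P(x) \<mapsto> P(x + c)\<close> of polynomials of degree less than \<open>n\<close>, in the monomial basis.\<close>
  define Y :: "nat \<Rightarrow> int mat" where
    "Y c = mat n n (\<lambda>(k, l). of_nat (l choose k) * of_nat c ^ (l - k))" for c
  have A: "A \<in> carrier_mat n n" and Y: "Y c \<in> carrier_mat n n" for c
    by (auto simp: A_def Y_def)
  have detA: "det A = 1"
    by (subst det_lower_triangular[OF _ A])
      (auto simp: A_def intro!: prod_list_diag_eq_one[of _ n])
  have detY: "det (Y c) = 1" for c
    by (subst det_upper_triangular[OF _ Y])
      (auto simp: Y_def upper_triangular_def binomial_eq_0 intro!: prod_list_diag_eq_one[of _ n])
  show ?thesis
  proof (rule that[of "\<lambda>j. A * Y (m * j)"])
    show "A * Y (m * j) \<in> carrier_mat n n" for j using A Y by simp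
    show "det (A * Y (m * j)) = 1" for j using det_mult[OF A Y] detA detY by simp
    fix w :: "rat vec" assume w: "w \<in> carrier_vec n" "w \<noteq> 0\<^sub>v n"
    define P :: "complex poly" where "P = (\<Sum>l<n. monom (of_real (of_rat (w $ l))) l)"
    have coeffP: "coeff P l = (if l < n then of_real (of_rat (w $ l)) else 0)" for l
      by (simp add: P_def coeff_sum)
    have "P \<noteq> 0"
    proof
      assume "P = 0"
      have "w $ l = 0" if "l < n" for l using coeffP[of l] that \<open>P = 0\<close> by simp
      then have "w = 0\<^sub>v n" using w(1) by (intro eq_vecI) auto
      then show False using w(2) by simp
    qed
    have "degree P < n"
      using n degree_le[of "n - 1" P] coeffP by fastforce
    define J where "J = {j :: nat. \<exists>k>0. cmod (coeff (P \<circ>\<^sub>p [:of_nat (m * j), 1:]) k)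
      > real_of_rat d * cmod (poly P (of_nat (m * j)))}"
    have J: "finite J" "card J \<le> n"
      using m[OF \<open>P \<noteq> 0\<close> \<open>degree P < n\<close>] unfolding J_def by auto
    have "map_mat rat_of_int (A * Y (m * j)) *\<^sub>v w \<in> line_nbhd n (of_nat t) d" if "j \<notin> J" for j
    proof -
      define c where "c = m * j"
      define y where "y = map_mat rat_of_int (Y c) *\<^sub>v w"
      have y: "y \<in> carrier_vec n" unfolding y_def using Y[of c] w(1) by simp
      have coeff_y: "coeff (P \<circ>\<^sub>p [:of_nat c, 1:]) k = of_real (of_rat (y $ k))" if "k < n" for k
      proof -
        have "y $ k = (\<Sum>l<n. of_nat (l choose k) * of_nat c ^ (l - k) * w $ l)"
          unfolding y_def using that w(1) Y[of c]
          by (subst index_mult_mat_vec_sum[of _ n n]) (auto simp: Y_def)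
        then show ?thesis
          by (simp add: P_def coeff_translate_eq_sum of_rat_sum of_rat_mult of_rat_power)
      qed
      have P0: "poly P (of_nat c) = of_real (of_rat (y $ 0))"
        using coeff_y[OF n] by (simp add: pcompose_coeff_0)
      have bound: "cmod (coeff (P \<circ>\<^sub>p [:of_nat c, 1:]) k) \<le> real_of_rat d * cmod (poly P (of_nat c))"
        if "k > 0" for k
      proof (rule ccontr)
        assume "\<not> ?thesis"
        then have "j \<in> J"
          using that unfolding J_def c_def by (intro CollectI exI[of _ k] conjI) (simp_all only: not_le)
        with \<open>j \<notin> J\<close> show False by simp
      qed
      have y_le: "\<bar>y $ k\<bar> \<le> d * \<bar>y $ 0\<bar>" if "k > 0" "k < n" for k
      proof -
        have "real_of_rat \<bar>y $ k\<bar> \<le> real_of_rat (d * \<bar>y $ 0\<bar>)"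
          using bound[OF that(1)] unfolding coeff_y[OF that(2)] P0 cmod_of_rat
          by (simp only: of_rat_mult)
        then show ?thesis by (simp only: of_rat_less_eq)
      qed
      \<comment> \<open>If the constant coefficient vanished, \<open>bound\<close> would kill all
        the others, and translation is injective on polynomials.\<close>
      have y0: "y $ 0 \<noteq> 0"
      proof
        assume "y $ 0 = 0"
        then have P00: "poly P (of_nat c) = 0" using P0 by simp
        have "coeff (P \<circ>\<^sub>p [:of_nat c, 1:]) k = 0" for k
          using bound[of k] P00 by (cases "k = 0") (simp_all add: pcompose_coeff_0)
        then have "P \<circ>\<^sub>p [:of_nat c, 1:] = 0" by (simp add: poly_eq_iff)
        then have "P = 0" by (rule pcompose_eq_0) simp
        with \<open>P \<noteq> 0\<close> show False by simp
      qed
      define x where "x = map_mat rat_of_int A *\<^sub>v y"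
      have x: "x \<in> carrier_vec n" unfolding x_def using A y by simp
      \<comment> \<open>So \<open>x $ 0 = y $ 0\<close>, and
        \<open>x $ i - of_nat t ^ i * x $ 0\<close> is just \<open>y $ i\<close> for
        \<open>i > 0\<close>: passing from the axis to the line costs nothing in
        \<open>d\<close>.\<close>
      have x_i: "x $ i = of_nat t ^ i * y $ 0 + (if i = 0 then 0 else y $ i)" if "i < n" for i
      proof -
        have "x $ i = (\<Sum>l<n. (if l = 0 then of_nat t ^ i else if i = l then 1 else 0) * y $ l)"
          unfolding x_def using that y A
          by (subst index_mult_mat_vec_sum[of _ n n]) (auto simp: A_def intro!: sum.cong)
        also have "\<dots> = (\<Sum>l<n. (if l = 0 then of_nat t ^ i * y $ 0 else 0)
            + (if l = i then if i = 0 then 0 else y $ i else 0))"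
          by (intro sum.cong) auto
        also have "\<dots> = of_nat t ^ i * y $ 0 + (if i = 0 then 0 else y $ i)"
          using n that by (simp add: sum.distrib)
        finally show ?thesis .
      qed
      have "x \<in> line_nbhd n (of_nat t) d"
        using x y0 y_le n d by (auto simp: line_nbhd_def x_i)
      moreover have "map_mat rat_of_int (A * Y c) *\<^sub>v w = x"
        unfolding x_def y_def using A Y[of c] w(1)
        by (simp add: of_int_hom.mat_hom_mult[OF A Y] assoc_mult_mat_vec[of _ n n _ n])
      ultimately show ?thesis by (simp add: c_def)
    qed
    then have sub: "{j. map_mat rat_of_int (A * Y (m * j)) *\<^sub>v w \<notin> line_nbhd n (of_nat t) d} \<subseteq> J"
      by blast
    show "finite {j. map_mat rat_of_int (A * Y (m * j)) *\<^sub>v w \<notin> line_nbhd n (of_nat t) d} \<and>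
      card {j. map_mat rat_of_int (A * Y (m * j)) *\<^sub>v w \<notin> line_nbhd n (of_nat t) d} \<le> n"
      using finite_subset[OF sub J(1)] card_mono[OF J(1) sub] J(2) by linarith
  qed
qed

section \<open>The groups\<close>

text \<open>For \<open>n > 0\<close> a diagonal entry of the equation shows
  \<open>c \<noteq> 0\<close>; for \<open>n = 0\<close> there are no entries to compare.\<close>

lemma scalar_inverse_scalar:
  fixes B :: "'a :: field mat"
  assumes B: "B \<in> carrier_mat n n" and cB: "c \<cdot>\<^sub>m B = 1\<^sub>m n"
  shows "B = inverse c \<cdot>\<^sub>m 1\<^sub>m n"
proof (rule eq_matI)
  fix i j assume "i < dim_row (inverse c \<cdot>\<^sub>m 1\<^sub>m n)" "j < dim_col (inverse c \<cdot>\<^sub>m 1\<^sub>m n)"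
  then have ij: "i < n" "j < n" by auto
  have entry: "c * B $$ (k, l) = (if k = l then 1 else 0)" if "k < n" "l < n" for k l
    using arg_cong[OF cB, of "\<lambda>M. M $$ (k, l)"] B that by simp
  have "c \<noteq> 0" using entry[of i i] ij by auto
  then show "B $$ (i, j) = (inverse c \<cdot>\<^sub>m 1\<^sub>m n) $$ (i, j)"
    using entry[OF ij] ij by (auto simp: field_simps)
qed (use B in auto)

lemma normal_scalars_GL_Q: "scalars_GL_Q n \<lhd> GL_Q n"
proof -
  interpret G: group "GL_Q n" by (rule group_GL_Q)
  have central: "x \<otimes>\<^bsub>GL_Q n\<^esub> s = s \<otimes>\<^bsub>GL_Q n\<^esub> x"
    if "x \<in> carrier (GL_Q n)" "s \<in> scalars_GL_Q n" for x s
    using that by (auto simp: scalars_GL_Q_def carrier_GL_Q scalar_mat_mult)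
  have sub: "subgroup (scalars_GL_Q n) (GL_Q n)"
  proof (rule G.subgroupI)
    show "scalars_GL_Q n \<subseteq> carrier (GL_Q n)" by (auto simp: scalars_GL_Q_def)
    have "1\<^sub>m n = (1 :: rat) \<cdot>\<^sub>m 1\<^sub>m n" by (auto intro!: eq_matI)
    then have "1\<^sub>m n \<in> scalars_GL_Q n"
      using G.one_closed unfolding scalars_GL_Q_def by auto
    then show "scalars_GL_Q n \<noteq> {}" by blast
    fix a assume a: "a \<in> scalars_GL_Q n"
    then obtain c where c: "a = c \<cdot>\<^sub>m 1\<^sub>m n" and aG: "a \<in> carrier (GL_Q n)"
      by (auto simp: scalars_GL_Q_def)
    have inv: "inv\<^bsub>GL_Q n\<^esub> a \<in> carrier (GL_Q n)" using aG by simp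
    then have B: "inv\<^bsub>GL_Q n\<^esub> a \<in> carrier_mat n n" by (simp add: carrier_GL_Q)
    have "a * inv\<^bsub>GL_Q n\<^esub> a = 1\<^sub>m n" using G.r_inv[OF aG] by simp
    then have "c \<cdot>\<^sub>m inv\<^bsub>GL_Q n\<^esub> a = 1\<^sub>m n" using scalar_mat_mult(1)[OF B, of c] c by simp
    then have "inv\<^bsub>GL_Q n\<^esub> a = inverse c \<cdot>\<^sub>m 1\<^sub>m n" by (rule scalar_inverse_scalar[OF B])
    then show "inv\<^bsub>GL_Q n\<^esub> a \<in> scalars_GL_Q n" using inv by (auto simp: scalars_GL_Q_def)
    fix b assume b: "b \<in> scalars_GL_Q n"
    then obtain e where e: "b = e \<cdot>\<^sub>m 1\<^sub>m n" and bG: "b \<in> carrier (GL_Q n)"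
      by (auto simp: scalars_GL_Q_def)
    have "a \<otimes>\<^bsub>GL_Q n\<^esub> b = (c * e) \<cdot>\<^sub>m 1\<^sub>m n"
      unfolding mult_GL_Q c e by (subst scalar_mat_mult(1)) (auto intro!: eq_matI)
    then show "a \<otimes>\<^bsub>GL_Q n\<^esub> b \<in> scalars_GL_Q n"
      using G.m_closed[OF aG bG] by (auto simp: scalars_GL_Q_def)
  qed
  show ?thesis
    unfolding G.normal_inv_iff
  proof (intro conjI sub ballI)
    fix x s assume xs: "x \<in> carrier (GL_Q n)" "s \<in> scalars_GL_Q n"
    have "s \<in> carrier (GL_Q n)" using xs(2) by (simp add: scalars_GL_Q_def)
    then have "x \<otimes>\<^bsub>GL_Q n\<^esub> s \<otimes>\<^bsub>GL_Q n\<^esub> inv\<^bsub>GL_Q n\<^esub> x = s"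
      using xs(1) by (simp only: central[OF xs] G.m_assoc G.inv_closed G.r_inv G.r_one)
    then show "x \<otimes>\<^bsub>GL_Q n\<^esub> s \<otimes>\<^bsub>GL_Q n\<^esub> inv\<^bsub>GL_Q n\<^esub> x \<in> scalars_GL_Q n"
      using xs(2) by simp
  qed
qed

section \<open>The projective group and the integral subgroup\<close>

abbreviation PGL_class :: "nat \<Rightarrow> rat mat \<Rightarrow> rat mat set" where
  "PGL_class n M \<equiv> scalars_GL_Q n #>\<^bsub>GL_Q n\<^esub> M"

lemma group_PGL_Q: "group (PGL_Q n)"
  unfolding PGL_Q_def by (rule normal.factorgroup_is_group[OF normal_scalars_GL_Q])

lemma carrier_PGL_Q: "carrier (PGL_Q n) = PGL_class n ` carrier (GL_Q n)"
  by (auto simp: PGL_Q_def FactGroup_def RCOSETS_def)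

lemma mult_PGL_class:
  assumes "A \<in> carrier (GL_Q n)" "B \<in> carrier (GL_Q n)"
  shows "PGL_class n A \<otimes>\<^bsub>PGL_Q n\<^esub> PGL_class n B = PGL_class n (A * B)"
  using normal.rcos_sum[OF normal_scalars_GL_Q assms] by (simp add: PGL_Q_def FactGroup_def)

lemma subgroup_scalars_GL_Q: "subgroup (scalars_GL_Q n) (GL_Q n)"
  using normal_scalars_GL_Q by (simp add: normal_def)

lemma one_PGL_Q: "\<one>\<^bsub>PGL_Q n\<^esub> = scalars_GL_Q n"
  by (simp add: PGL_Q_def FactGroup_def)

lemma PGL_class_hom: "PGL_class n \<in> hom (GL_Q n) (PGL_Q n)"
  by (auto simp: hom_def carrier_PGL_Q mult_PGL_class)

lemma map_SL_Z_in_GL_Q: "A \<in> carrier (SL_Z n) \<Longrightarrow> map_mat rat_of_int A \<in> carrier (GL_Q n)"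
  by (auto simp: SL_Z_def carrier_GL_Q of_int_hom.hom_det)

lemma subgroup_map_SL_Z: "subgroup (map_mat rat_of_int ` carrier (SL_Z n)) (GL_Q n)"
proof -
  interpret G: group "GL_Q n" by (rule group_GL_Q)
  show ?thesis
  proof (rule G.subgroupI)
    show "map_mat rat_of_int ` carrier (SL_Z n) \<subseteq> carrier (GL_Q n)"
      using map_SL_Z_in_GL_Q by blast
    have "1\<^sub>m n \<in> carrier (SL_Z n)" by (simp add: SL_Z_def)
    then show "map_mat rat_of_int ` carrier (SL_Z n) \<noteq> {}" by blast
  next
    fix a assume "a \<in> map_mat rat_of_int ` carrier (SL_Z n)"
    then obtain A where a: "a = map_mat rat_of_int A" and AS: "A \<in> carrier (SL_Z n)" by blast
    then have A: "A \<in> carrier_mat n n" "det A = 1" by (auto simp: SL_Z_def)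
    \<comment> \<open>With determinant 1 the adjugate is the inverse, and its entries are
      integers.\<close>
    note adj = adj_mat[OF A(1)]
    have 1: "adj_mat A * A = 1\<^sub>m n" using adj(3) A(2) by (auto intro!: eq_matI)
    have "det (adj_mat A) = 1" using det_mult[OF adj(1) A(1)] A(2) by (simp add: 1)
    then have adjS: "adj_mat A \<in> carrier (SL_Z n)" using adj(1) by (simp add: SL_Z_def)
    have "map_mat rat_of_int (adj_mat A) * a = 1\<^sub>m n"
      unfolding a of_int_hom.mat_hom_mult[OF adj(1) A(1), symmetric] 1
      by (simp add: of_int_hom.mat_hom_one)
    then have "inv\<^bsub>GL_Q n\<^esub> a = map_mat rat_of_int (adj_mat A)"
      using map_SL_Z_in_GL_Q[OF AS] map_SL_Z_in_GL_Q[OF adjS] a by (intro G.inv_equality) auto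
    then show "inv\<^bsub>GL_Q n\<^esub> a \<in> map_mat rat_of_int ` carrier (SL_Z n)" using adjS by simp
    fix b assume "b \<in> map_mat rat_of_int ` carrier (SL_Z n)"
    then obtain B where b: "b = map_mat rat_of_int B" and B: "B \<in> carrier_mat n n" "det B = 1"
      by (auto simp: SL_Z_def)
    have "A * B \<in> carrier (SL_Z n)" using A B det_mult[OF A(1) B(1)] by (simp add: SL_Z_def)
    then show "a \<otimes>\<^bsub>GL_Q n\<^esub> b \<in> map_mat rat_of_int ` carrier (SL_Z n)"
      unfolding mult_GL_Q a b of_int_hom.mat_hom_mult[OF A(1) B(1), symmetric] by (rule imageI)
  qed
qed

text \<open>This describes the subgroup by integral representatives in \<open>GL_Q n\<close>, so
  that it is the image of a subgroup under the quotient homomorphism.\<close>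

lemma image_PSL_Z:
  "PSL_to_PGL n ` carrier (PSL_Z n) = PGL_class n ` map_mat rat_of_int ` carrier (SL_Z n)"
proof -
  have "carrier (PSL_Z n) = (\<lambda>A. scalars_SL_Z n #>\<^bsub>SL_Z n\<^esub> A) ` carrier (SL_Z n)"
    by (auto simp: PSL_Z_def FactGroup_def RCOSETS_def)
  then show ?thesis by (simp add: image_image PSL_to_PGL_coset cong: image_cong)
qed

lemma subgroup_image_PSL_Z: "subgroup (PSL_to_PGL n ` carrier (PSL_Z n)) (PGL_Q n)"
proof -
  interpret group_hom "GL_Q n" "PGL_Q n" "PGL_class n"
    by (intro group_hom.intro group_GL_Q group_PGL_Q group_hom_axioms.intro PGL_class_hom)
  show ?thesis
    unfolding image_PSL_Z by (rule subgroup_img_is_subgroup[OF subgroup_map_SL_Z])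
qed

section \<open>The action on rational lines\<close>

text \<open>Both conditions are pulled back from projective space along the orbit map of a base
  line: nontrivial classes have nonscalar representatives, which displace a neighbourhood, and
  integral matrices bring every line into it with few exceptions.\<close>

lemma PSL_Z_displaces:
  assumes F: "finite F" "F \<subseteq> carrier (PGL_Q n) - {\<one>\<^bsub>PGL_Q n\<^esub>}"
  shows "\<exists>K U k. (\<forall>g\<in>F. \<forall>x\<in>U. g \<otimes>\<^bsub>PGL_Q n\<^esub> x \<notin> U) \<and> range k \<subseteq> PSL_to_PGL n ` carrier (PSL_Z n) \<and>
    (\<forall>x\<in>carrier (PGL_Q n). finite {j :: nat. k j \<otimes>\<^bsub>PGL_Q n\<^esub> x \<notin> U} \<and>
      card {j. k j \<otimes>\<^bsub>PGL_Q n\<^esub> x \<notin> U} \<le> K)"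
proof (cases "F = {}")
  \<comment> \<open>With nothing to displace, the whole type can serve as \<open>U\<close> and there
    are no exceptions. This case covers \<open>n = 0\<close>: a nonempty \<open>F\<close> forces
    \<open>n > 0\<close>, since every matrix of size 0 is scalar.\<close>
  case True
  have "\<one>\<^bsub>PGL_Q n\<^esub> \<in> PSL_to_PGL n ` carrier (PSL_Z n)"
    by (rule subgroup.one_closed[OF subgroup_image_PSL_Z])
  then show ?thesis
    using True by (intro exI[of _ 0] exI[of _ UNIV] exI[of _ "\<lambda>_. \<one>\<^bsub>PGL_Q n\<^esub>"]) auto
next
  case False
  interpret G: group "GL_Q n" by (rule group_GL_Q)
  interpret N: subgroup "scalars_GL_Q n" "GL_Q n" by (rule subgroup_scalars_GL_Q)
  have "\<exists>R\<in>carrier (GL_Q n). g = PGL_class n R" if "g \<in> F" for g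
    using that F(2) unfolding carrier_PGL_Q by blast
  then obtain R where R: "\<And>g. g \<in> F \<Longrightarrow> R g \<in> carrier (GL_Q n)" "\<And>g. g \<in> F \<Longrightarrow> g = PGL_class n (R g)"
    by metis
  have nonscalar: "R g \<noteq> c \<cdot>\<^sub>m 1\<^sub>m n" if g: "g \<in> F" for g c
  proof
    assume "R g = c \<cdot>\<^sub>m 1\<^sub>m n"
    then have "R g \<in> scalars_GL_Q n" using R(1)[OF g] by (auto simp: scalars_GL_Q_def)
    then have "g = \<one>\<^bsub>PGL_Q n\<^esub>"
      using R[OF g] G.coset_join2[OF R(1)[OF g] subgroup_scalars_GL_Q] by (simp add: one_PGL_Q)
    then show False using g F(2) by blast
  qed
  have n: "n > 0"
  proof (rule ccontr)
    assume "\<not> n > 0"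
    obtain g where g: "g \<in> F" using False by blast
    have "R g = 1 \<cdot>\<^sub>m 1\<^sub>m n"
      using R(1)[OF g] \<open>\<not> n > 0\<close> by (auto simp: carrier_GL_Q intro!: eq_matI)
    then show False using nonscalar[OF g] by blast
  qed
  have "\<exists>t :: nat. \<exists>d>0. \<forall>g\<in>F. \<forall>x\<in>line_nbhd n (of_nat t) d. R g *\<^sub>v x \<notin> line_nbhd n (of_nat t) d"
  proof (rule line_nbhd_finitely_displaced[of "R ` F" n])
    show "finite (R ` F)" using F(1) by simp
    show "M \<in> carrier_mat n n" if "M \<in> R ` F" for M
      using that R(1) by (auto simp: carrier_GL_Q)
    show "M \<noteq> c \<cdot>\<^sub>m 1\<^sub>m n" if "M \<in> R ` F" for M c
      using that nonscalar by auto
  qed (use n in blast)+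
  then obtain t :: nat and d where d: "d > 0"
    and disp: "\<And>g x. g \<in> F \<Longrightarrow> x \<in> line_nbhd n (of_nat t) d \<Longrightarrow> R g *\<^sub>v x \<notin> line_nbhd n (of_nat t) d"
    by blast
  obtain k :: "nat \<Rightarrow> int mat" where k: "\<And>j. k j \<in> carrier_mat n n" "\<And>j. det (k j) = 1"
    and ret: "\<And>w. w \<in> carrier_vec n \<Longrightarrow> w \<noteq> 0\<^sub>v n \<Longrightarrow>
      finite {j. map_mat rat_of_int (k j) *\<^sub>v w \<notin> line_nbhd n (of_nat t) d} \<and>
      card {j. map_mat rat_of_int (k j) *\<^sub>v w \<notin> line_nbhd n (of_nat t) d} \<le> n"
    using returns_to_line_nbhd[OF n d] by metis
  define v :: "rat vec" where "v = unit_vec n 0"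
  have v: "v \<in> carrier_vec n" "v \<noteq> 0\<^sub>v n"
    using n by (auto simp: v_def dest: arg_cong[of _ _ "\<lambda>x. x $ 0"])
  \<comment> \<open>A class belongs to \<open>U\<close> when it carries the base line, spanned by
    \<open>v\<close>, into the neighbourhood. One representative suffices because the neighbourhood
    is invariant under nonzero scalars.\<close>
  define U where "U = {C \<in> carrier (PGL_Q n). \<exists>M\<in>C. M *\<^sub>v v \<in> line_nbhd n (of_nat t) d}"
  define h where "h j = PGL_class n (map_mat rat_of_int (k j))" for j
  have kS: "k j \<in> carrier (SL_Z n)" for j using k by (simp add: SL_Z_def)
  have "g \<otimes>\<^bsub>PGL_Q n\<^esub> C \<notin> U" if g: "g \<in> F" and C: "C \<in> U" for g C
  proof
    assume gC: "g \<otimes>\<^bsub>PGL_Q n\<^esub> C \<in> U"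
    obtain M where M: "M \<in> C" "M *\<^sub>v v \<in> line_nbhd n (of_nat t) d" using C by (auto simp: U_def)
    obtain M0 where M0: "M0 \<in> carrier (GL_Q n)" "C = PGL_class n M0"
      using C by (auto simp: U_def carrier_PGL_Q)
    have MG: "M \<in> carrier (GL_Q n)" using N.elemrcos_carrier[OF G.is_group M0(1)] M(1) M0(2) by simp
    have C_eq: "C = PGL_class n M"
      using G.repr_independence[OF _ M0(1) subgroup_scalars_GL_Q] M(1) M0(2) by simp
    have "g \<otimes>\<^bsub>PGL_Q n\<^esub> C = PGL_class n (R g * M)"
      using mult_PGL_class[OF R(1)[OF g] MG] R(2)[OF g] C_eq by simp
    then obtain M' where M': "M' \<in> PGL_class n (R g * M)" "M' *\<^sub>v v \<in> line_nbhd n (of_nat t) d"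
      using gC by (auto simp: U_def)
    have mats: "R g \<in> carrier_mat n n" "M \<in> carrier_mat n n"
      using R(1)[OF g] MG by (auto simp: carrier_GL_Q)
    obtain c where "M' = (c \<cdot>\<^sub>m 1\<^sub>m n) * (R g * M)"
      using M'(1) by (auto simp: r_coset_def scalars_GL_Q_def)
    then have "M' = c \<cdot>\<^sub>m (R g * M)" using scalar_mat_mult(1)[of "R g * M" n c] mats by simp
    then have eq: "M' *\<^sub>v v = c \<cdot>\<^sub>v (R g *\<^sub>v (M *\<^sub>v v))"
      using mats v(1)
      by (simp add: smult_mat_mult_vec[of _ n n] assoc_mult_mat_vec[of _ n n _ n])
    have xn: "R g *\<^sub>v (M *\<^sub>v v) \<in> carrier_vec n" using mats v(1) by simp
    \<comment> \<open>Vectors of the neighbourhood have a nonzero coordinate 0, so the scalar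
      \<open>c\<close> relating the two representatives is nonzero and can be divided out.\<close>
    have "(M' *\<^sub>v v) $ 0 = c * (R g *\<^sub>v (M *\<^sub>v v)) $ 0"
      unfolding eq using n by (intro index_smult_vec(1)) (simp only: carrier_vecD[OF xn])
    then have "c \<noteq> 0" using M'(2) by (auto simp: line_nbhd_def)
    then have "inverse c \<cdot>\<^sub>v (M' *\<^sub>v v) = R g *\<^sub>v (M *\<^sub>v v)"
      unfolding eq by (simp add: smult_smult_assoc)
    moreover have "inverse c \<cdot>\<^sub>v (M' *\<^sub>v v) \<in> line_nbhd n (of_nat t) d"
      using M'(2) \<open>c \<noteq> 0\<close> n by (intro line_nbhd_smult) auto
    ultimately show False using disp[OF g M(2)] by simp
  qed
  moreover have "range h \<subseteq> PSL_to_PGL n ` carrier (PSL_Z n)"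
    unfolding image_PSL_Z h_def using kS by blast
  moreover have "finite {j. h j \<otimes>\<^bsub>PGL_Q n\<^esub> C \<notin> U} \<and> card {j. h j \<otimes>\<^bsub>PGL_Q n\<^esub> C \<notin> U} \<le> n"
    if "C \<in> carrier (PGL_Q n)" for C
  proof -
    from that obtain M where MG: "M \<in> carrier (GL_Q n)" and C: "C = PGL_class n M"
      by (auto simp: carrier_PGL_Q)
    have M: "M \<in> carrier_mat n n" using MG by (simp add: carrier_GL_Q)
    have wn: "M *\<^sub>v v \<in> carrier_vec n" using M v(1) by simp
    have w0: "M *\<^sub>v v \<noteq> 0\<^sub>v n"
      using det_0_iff_vec_prod_zero[OF M] v MG by (auto simp: carrier_GL_Q)
    let ?J = "{j. map_mat rat_of_int (k j) *\<^sub>v (M *\<^sub>v v) \<notin> line_nbhd n (of_nat t) d}"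
    have "h j \<otimes>\<^bsub>PGL_Q n\<^esub> C \<in> U" if j: "j \<notin> ?J" for j
    proof -
      let ?K = "map_mat rat_of_int (k j)"
      have KG: "?K \<in> carrier (GL_Q n)" using map_SL_Z_in_GL_Q[OF kS] .
      have KM: "?K * M \<in> carrier (GL_Q n)" using G.m_closed[OF KG MG] by simp
      have hC: "h j \<otimes>\<^bsub>PGL_Q n\<^esub> C = PGL_class n (?K * M)"
        unfolding h_def C by (rule mult_PGL_class[OF KG MG])
      have "(?K * M) *\<^sub>v v = ?K *\<^sub>v (M *\<^sub>v v)"
        using assoc_mult_mat_vec[of ?K n n M n v] k(1)[of j] M v(1) by simp
      moreover have "?K * M \<in> PGL_class n (?K * M)"
        by (rule G.rcos_self[OF KM subgroup_scalars_GL_Q])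
      ultimately show ?thesis using j KM
        unfolding hC U_def carrier_PGL_Q by (auto intro!: bexI[of _ "?K * M"])
    qed
    then have sub: "{j. h j \<otimes>\<^bsub>PGL_Q n\<^esub> C \<notin> U} \<subseteq> ?J" by blast
    have J: "finite ?J" "card ?J \<le> n" using ret[OF wn w0] by auto
    show ?thesis using finite_subset[OF sub J(1)] card_mono[OF J(1) sub] J(2) by linarith
  qed
  ultimately show ?thesis
    by (intro exI[of _ n] exI[of _ U] exI[of _ h]) blast
qed

theorem corollary3p7:
  fixes n :: nat
  shows "cstar_irreducible (PGL_Q n) (PSL_to_PGL n ` carrier (PSL_Z n))"
  by (rule group.cstar_irreducibleI[OF group_PGL_Q subgroup_image_PSL_Z PSL_Z_displaces])

end
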